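(* Let $\xi$ be the Rosenblatt process with parameter $H\in(\frac12,1)$. For any $0<s<t$, the increments $\xi_t-\xi_s$ and $\xi_{t+\tau}-\xi_{s+\tau}$ are asymptotically independent as $\tau\to\infty$, i.e., if $\mu_{(s,t)}$ is the law of $\xi_t-\xi_s$ and $\mu_{(s,t),(s+\tau,t+\tau)}$ is the law of $(\xi_t-\xi_s,\xi_{t+\tau}-\xi_{s+\tau})$, then $\mu_{(s,t),(s+\tau,t+\tau)}$ converges weakly, as $\tau\to\infty$, to $\mu_{(s,t)}\otimes\mu_{(s,t)}$ $(=\mu_{(s,t)}\otimes\mu_{(s+\tau,t+\tau)})$.
   Context: Rosenblatt process with parameter $H\in(\frac12,1)$: the real process $\xi=(\xi_t)_{t\ge0}$ whose finite-dimensional distributions are determined by $$E\exp\Big\{i\sum_{j=1}^p\theta_j\xi_{t_j}\Big\}=\exp\Big\{\frac12\sum_{k=2}^\infty\frac{(2i\sigma)^k}{k}R_{H,k}(\theta_1,\dots,\theta_p;t_1,\dots,t_p)\Big\}$$ for $(\theta_1,\dots,\theta_p)$ in a small neighborhood of $0$ (depending on $t_1,\dots,t_p$), where $\sigma=[\frac12H(2H-1)]^{1/2}$, $$R_{H,k}=\int_{\mathbb R^k}\psi(x_1)\cdots\psi(x_k)|x_1-x_2|^{H-1}|x_2-x_3|^{H-1}\cdots|x_{k-1}-x_k|^{H-1}|x_k-x_1|^{H-1}dx_1\cdots dx_k,$$ and $\psi=\sum_{j=1}^p\theta_j\mathbf 1_{[0,t_j]}$. The process has stationary increments. *)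

theory Defs
  imports "HOL-Probability.Probability"
begin

definition rosenblatt_sigma :: "real \<Rightarrow> real" where
  "rosenblatt_sigma H = sqrt (H * (2 * H - 1) / 2)"

text \<open>Finite families \<open>\<theta>\<^sub>1, \<dots>, \<theta>\<^sub>p\<close> and \<open>t\<^sub>1, \<dots>, t\<^sub>p\<close> are functions on \<^typ>\<open>nat\<close>,
  used only at the indices below \<open>p\<close>.\<close>

definition step_psi :: "nat \<Rightarrow> (nat \<Rightarrow> real) \<Rightarrow> (nat \<Rightarrow> real) \<Rightarrow> real \<Rightarrow> real" where
  "step_psi p \<theta> t x = (\<Sum>j<p. \<theta> j * indicator {0..t j} x)"

text \<open>The coordinates \<open>x\<^sub>1, \<dots>, x\<^sub>k\<close> are numbered from \<open>0\<close>; \<open>Suc i mod k\<close> is the cyclic successor,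
  so that the last factor is \<open>\<bar>x\<^sub>k - x\<^sub>1\<bar>\<close> to the power \<open>H - 1\<close>. The convention \<open>0 powr (H - 1) = 0\<close>
  only matters on a null set.\<close>

definition cyclic_R ::
  "real \<Rightarrow> nat \<Rightarrow> nat \<Rightarrow> (nat \<Rightarrow> real) \<Rightarrow> (nat \<Rightarrow> real) \<Rightarrow> real" where
  "cyclic_R H k p \<theta> t =
     (\<integral>x. (\<Prod>i<k. step_psi p \<theta> t (x i)) * (\<Prod>i<k. \<bar>x i - x (Suc i mod k)\<bar> powr (H - 1))
        \<partial>(\<Pi>\<^sub>M i\<in>{..<k}. lborel))"

definition cumulant_term ::
  "real \<Rightarrow> nat \<Rightarrow> (nat \<Rightarrow> real) \<Rightarrow> (nat \<Rightarrow> real) \<Rightarrow> nat \<Rightarrow> complex" where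
  "cumulant_term H p \<theta> t k =
     (2 * \<i> * of_real (rosenblatt_sigma H)) ^ k / of_nat k * of_real (cyclic_R H k p \<theta> t)"

text \<open>Only the values \<open>\<xi> u\<close> for \<open>u \<ge> 0\<close> are constrained. The neighbourhood of \<open>0\<close> (the \<open>\<epsilon>\<close>) may
  depend on \<open>t\<^sub>1, \<dots>, t\<^sub>p\<close>. Convergence of the series is part of the formula, since \<^const>\<open>suminf\<close>
  is meaningless otherwise. The series starts at \<open>k = 2\<close>, whence the shift.\<close>

definition rosenblatt_process ::
  "real \<Rightarrow> 'a measure \<Rightarrow> (real \<Rightarrow> 'a \<Rightarrow> real) \<Rightarrow> bool" where
  "rosenblatt_process H M \<xi> \<longleftrightarrow>
     prob_space M \<and>
     (\<forall>u\<ge>0. \<xi> u \<in> borel_measurable M) \<and>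
     (\<forall>p t. (\<forall>j<p. 0 \<le> t j) \<longrightarrow>
        (\<exists>\<epsilon>>0. \<forall>\<theta>. (\<forall>j<p. \<bar>\<theta> j\<bar> < \<epsilon>) \<longrightarrow>
           summable (\<lambda>k. cumulant_term H p \<theta> t (k + 2)) \<and>
           (\<integral>\<omega>. exp (\<i> * of_real (\<Sum>j<p. \<theta> j * \<xi> (t j) \<omega>)) \<partial>M) =
             exp (1 / 2 * (\<Sum>k. cumulant_term H p \<theta> t (k + 2)))))"

definition increment_law ::
  "'a measure \<Rightarrow> (real \<Rightarrow> 'a \<Rightarrow> real) \<Rightarrow> real \<Rightarrow> real \<Rightarrow> real measure" where
  "increment_law M \<xi> s t = distr M borel (\<lambda>\<omega>. \<xi> t \<omega> - \<xi> s \<omega>)"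

definition joint_increment_law ::
  "'a measure \<Rightarrow> (real \<Rightarrow> 'a \<Rightarrow> real) \<Rightarrow> real \<Rightarrow> real \<Rightarrow> real \<Rightarrow> real \<Rightarrow> (real \<times> real) measure" where
  "joint_increment_law M \<xi> s t s' t' =
     distr M borel (\<lambda>\<omega>. (\<xi> t \<omega> - \<xi> s \<omega>, \<xi> t' \<omega> - \<xi> s' \<omega>))"

text \<open>The library's \<^const>\<open>weak_conv_m\<close> covers only sequences of measures on the real line, via
  distribution functions; here a limit along a filter of measures on the plane is needed.\<close>

definition converges_weakly ::
  "('i \<Rightarrow> 'b::topological_space measure) \<Rightarrow> 'b measure \<Rightarrow> 'i filter \<Rightarrow> bool" where
  "converges_weakly \<mu> \<nu> F \<longleftrightarrow>
     (\<forall>f :: 'b \<Rightarrow> real. continuous_on UNIV f \<and> bounded (range f) \<longrightarrow>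
        ((\<lambda>i. \<integral>x. f x \<partial>\<mu> i) \<longlongrightarrow> (\<integral>x. f x \<partial>\<nu>)) F)"

end

theory Submission
  imports Defs "HOL-Complex_Analysis.Complex_Analysis"
begin

text \<open>
  Write \<open>X = \<xi>\<^sub>t - \<xi>\<^sub>s\<close> and \<open>Y\<^sub>\<tau> = \<xi>\<^sub>t\<^sub>+\<^sub>\<tau> - \<xi>\<^sub>s\<^sub>+\<^sub>\<tau>\<close>. Near the origin the characteristic function
  of \<open>u X + v Y\<^sub>\<tau>\<close> is the exponential of a power series whose \<open>k\<close>-th coefficient is a constant times
  the cyclic integral of \<open>\<psi> = u 1\<^sub>I + v 1\<^sub>J\<close>, where \<open>I = (s, t]\<close> and \<open>J = I + \<tau>\<close>. Expanding the product
  \<open>\<psi>(x\<^sub>1) \<dots> \<psi>(x\<^sub>k)\<close> gives one integral for each way of distributing the \<open>k\<close> points over \<open>I\<close> and \<open>J\<close>.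
  If all points lie in the same interval, translation invariance returns the cyclic integral of \<open>1\<^sub>I\<close>.
  Otherwise some cyclically adjacent pair of points is at a distance of order \<open>\<tau>\<close>, and since
  \<open>H - 1 < 0\<close> the corresponding kernel factor tends to \<open>0\<close>. Hence the \<open>k\<close>-th coefficient
  converges to \<open>u\<^sup>k + v\<^sup>k\<close> times the one of \<open>X\<close>, which is the coefficient that belongs to two independent
  copies of \<open>X\<close> (\<open>cyclic_integral_tendsto\<close>).

  The difficulty is to pass from the coefficients to the laws, because the neighbourhood of \<open>0\<close> on which the
  formula is known depends on \<open>\<tau>\<close> and might shrink to a point. Two facts overcome it. First, a
  characteristic function that agrees near \<open>0\<close> with a holomorphic function belongs to a law with an exponential
  moment (\<open>exponential_moment\<close>), so it extends holomorphically to a strip around the real axis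
  (\<open>complex_char_holomorphic\<close>) and is determined by its Taylor coefficients at \<open>0\<close>. In particular
  \<open>X\<close> and \<open>Y\<^sub>\<tau>\<close>, which have the same coefficients, have the same law \<open>\<mu>\<close> (\<open>log_coeffs_unique\<close>). Second, an
  exponential moment of \<open>u X + v Y\<^sub>\<tau>\<close> is controlled by one of \<open>\<mu>\<close>, hence uniformly in \<open>\<tau>\<close>
  (\<open>linear_law_exponential_moment\<close>). The characteristic functions therefore extend to a common strip with a common
  bound, and by Montel's theorem convergence of all Taylor coefficients at \<open>0\<close> implies pointwise convergence on
  the whole strip (\<open>bounded_holomorphic_seq_tendsto\<close>).

  It remains to deduce weak convergence in the plane from convergence of the characteristic functions. As all
  the laws involved have the same two marginals \<open>\<mu>\<close>, tightness is immediate, and on a large square a bounded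
  continuous function is approximated by trigonometric polynomials (\<open>converges_weakly_if_char_tendsto\<close>).
\<close>

section \<open>Holomorphic functions with convergent Taylor coefficients\<close>

text \<open>By Montel's theorem every subsequence has a further subsequence that converges locally uniformly. Its limit has the
  same derivatives at \<open>z\<close> as \<open>g\<close>, so it is \<open>g\<close> by the identity theorem.\<close>

lemma bounded_holomorphic_seq_tendsto:
  fixes f :: "nat \<Rightarrow> complex \<Rightarrow> complex"
  assumes S: "open S" "connected S" and z: "z \<in> S" and w: "w \<in> S"
    and f: "\<And>n. f n holomorphic_on S" and g: "g holomorphic_on S"
    and B: "\<And>n v. v \<in> S \<Longrightarrow> norm (f n v) \<le> B"
    and deriv: "\<And>k. (\<lambda>n. (deriv ^^ k) (f n) z) \<longlonglongrightarrow> (deriv ^^ k) g z"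
  shows "(\<lambda>n. f n w) \<longlonglongrightarrow> g w"
proof (rule ccontr)
  assume "\<not> (\<lambda>n. f n w) \<longlonglongrightarrow> g w"
  then obtain e where e: "e > 0" and "\<not> eventually (\<lambda>n. dist (f n w) (g w) < e) sequentially"
    by (auto simp: tendsto_iff)
  then obtain r :: "nat \<Rightarrow> nat" where r: "strict_mono r" "\<And>n. \<not> dist (f (r n) w) (g w) < e"
    using not_eventually_sequentiallyD by blast
  obtain h q where h: "h holomorphic_on S" and q: "strict_mono (q :: nat \<Rightarrow> nat)"
    and pw: "\<And>x. x \<in> S \<Longrightarrow> (\<lambda>n. f (r (q n)) x) \<longlonglongrightarrow> h x"
    and ul: "\<And>K. \<lbrakk>compact K; K \<subseteq> S\<rbrakk> \<Longrightarrow> uniform_limit K ((\<lambda>n. f (r n)) \<circ> q) h sequentially"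
  proof (rule Montel[of S "range f" "\<lambda>n. f (r n)"])
    show "\<exists>B. \<forall>h\<in>range f. \<forall>z\<in>K. norm (h z) \<le> B" if "compact K" "K \<subseteq> S" for K
      using B that by blast
  qed (use S f in auto)
  obtain \<rho> where \<rho>: "\<rho> > 0" "cball z \<rho> \<subseteq> S"
    using S z by (meson open_contains_cball)
  have rq: "strict_mono (r \<circ> q)"
    using r q by (simp add: strict_mono_o)
  (* Locally uniform convergence passes to all derivatives at z, where the limits are known. *)
  have "h w = g w"
  proof (rule holomorphic_fun_eq_on_connected[OF h g S])
    fix k
    have "(\<lambda>n. (deriv ^^ k) (((\<lambda>n. f (r n)) \<circ> q) n) z) \<longlonglongrightarrow> (deriv ^^ k) h z"
    proof (rule higher_deriv_complex_uniform_limit)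
      show "uniform_limit (ball z \<rho>) ((\<lambda>n. f (r n)) \<circ> q) h sequentially"
        by (rule uniform_limit_on_subset[OF ul[of "cball z \<rho>"]]) (use \<rho> in auto)
      show "\<forall>\<^sub>F n in sequentially. ((\<lambda>n. f (r n)) \<circ> q) n holomorphic_on ball z \<rho>"
        using \<rho> ball_subset_cball by (intro always_eventually) (auto intro!: holomorphic_on_subset[OF f])
    qed (use \<rho> in auto)
    moreover have "(\<lambda>n. (deriv ^^ k) (((\<lambda>n. f (r n)) \<circ> q) n) z) \<longlonglongrightarrow> (deriv ^^ k) g z"
      using LIMSEQ_subseq_LIMSEQ[OF deriv[of k] rq] by (simp add: o_def)
    ultimately show "(deriv ^^ k) h z = (deriv ^^ k) g z"
      by (rule LIMSEQ_unique)
  qed (use z w in auto)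
  then have "(\<lambda>n. f (r (q n)) w) \<longlonglongrightarrow> g w"
    using pw[OF w] by simp
  then have "eventually (\<lambda>n. dist (f (r (q n)) w) (g w) < e) sequentially"
    using e by (auto simp: tendsto_iff)
  then show False
    using r(2) by (auto dest: eventually_happens)
qed

text \<open>This is the Leibniz rule applied to \<open>f' = g' f\<close>. It expresses the Taylor coefficients of \<open>exp g\<close> as polynomials
  in finitely many coefficients of \<open>g\<close>, so that no bound on the tail of the series for \<open>g\<close> is required when a limit
  is taken.\<close>

lemma higher_deriv_exp_recurrence:
  assumes S: "open S" and f: "f holomorphic_on S" and g: "g holomorphic_on S"
    and z: "z \<in> S" and eq: "\<And>w. w \<in> S \<Longrightarrow> f w = exp (g w)"
  shows "(deriv ^^ Suc n) f z =
    (\<Sum>i=0..n. of_nat (n choose i) * (deriv ^^ Suc i) g z * (deriv ^^ (n - i)) f z)"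
proof -
  have d: "deriv f w = deriv g w * f w" if w: "w \<in> S" for w
  proof -
    have "(g has_field_derivative deriv g w) (at w)"
      using g S w by (rule holomorphic_derivI)
    then have "((\<lambda>w. exp (g w)) has_field_derivative deriv g w * f w) (at w)"
      using eq[OF w] by (auto intro!: derivative_eq_intros)
    then have "(f has_field_derivative deriv g w * f w) (at w)"
      by (rule has_field_derivative_transform_within_open[OF _ S w]) (simp add: eq)
    then show ?thesis
      by (rule DERIV_imp_deriv)
  qed
  have "(deriv ^^ Suc n) f z = (deriv ^^ n) (deriv f) z"
    by (simp only: funpow_Suc_right o_def)
  also have "\<dots> = (deriv ^^ n) (\<lambda>w. deriv g w * f w) z"
    using S f g z d
    by (intro higher_deriv_transform_within_open[of _ S]) (auto intro!: holomorphic_intros)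
  also have "\<dots> = (\<Sum>i=0..n. of_nat (n choose i) * (deriv ^^ i) (deriv g) z * (deriv ^^ (n - i)) f z)"
    using S f g z by (intro higher_deriv_mult[of _ S]) (auto intro!: holomorphic_intros)
  finally show ?thesis
    by (simp only: funpow_Suc_right o_def)
qed

text \<open>The logarithm of \<open>f\<close> is given by a power series near \<open>0\<close>. Only real arguments occur, because characteristic
  functions are known there only, and the radius \<open>\<epsilon>\<close> is kept existential: it carries no uniformity.\<close>

definition log_coeffs :: "(complex \<Rightarrow> complex) \<Rightarrow> (nat \<Rightarrow> complex) \<Rightarrow> bool" where
  "log_coeffs f \<kappa> \<longleftrightarrow> (\<exists>\<epsilon>>0. \<forall>x::real. \<bar>x\<bar> < \<epsilon> \<longrightarrow>
     summable (\<lambda>k. \<kappa> k * of_real x ^ k) \<and> f (of_real x) = exp (\<Sum>k. \<kappa> k * of_real x ^ k))"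

lemma log_coeffsE:
  assumes "log_coeffs f \<kappa>"
  obtains \<rho> g where "\<rho> > 0" "g holomorphic_on ball 0 \<rho>"
    "\<And>x::real. \<bar>x\<bar> < \<rho> \<Longrightarrow> f (of_real x) = exp (g (of_real x))"
    "\<And>k. (deriv ^^ k) g 0 = fact k * \<kappa> k"
proof -
  from assms[unfolded log_coeffs_def] obtain \<epsilon> where \<epsilon>: "\<epsilon> > 0" and
    *: "\<forall>x::real. \<bar>x\<bar> < \<epsilon> \<longrightarrow> summable (\<lambda>k. \<kappa> k * of_real x ^ k) \<and>
      f (of_real x) = exp (\<Sum>k. \<kappa> k * of_real x ^ k)"
    by (elim exE conjE)
  have sm: "summable (\<lambda>k. \<kappa> k * of_real x ^ k)"
    and f: "f (of_real x) = exp (\<Sum>k. \<kappa> k * of_real x ^ k)" if "\<bar>x\<bar> < \<epsilon>" for x :: real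
    using *[rule_format, OF that] by simp_all
  define F where "F = Abs_fps \<kappa>"
  define \<rho> where "\<rho> = \<epsilon> / 2"
  have \<rho>: "\<rho> > 0" "\<rho> < \<epsilon>"
    using \<epsilon> by (auto simp: \<rho>_def)
  have cr: "fps_conv_radius F \<ge> ereal \<rho>"
  proof -
    have "\<bar>\<rho>\<bar> < \<epsilon>"
      using \<rho> by simp
    then have "ereal (norm (complex_of_real \<rho>)) \<le> conv_radius \<kappa>"
      by (intro conv_radius_geI sm)
    moreover have "norm (complex_of_real \<rho>) = \<rho>"
      using \<rho> by simp
    moreover have "fps_nth F = \<kappa>"
      by (rule ext) (simp add: F_def)
    ultimately show ?thesis
      by (simp only: fps_conv_radius_def)
  qed
  have hol: "eval_fps F holomorphic_on ball 0 \<rho>"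
  proof (rule holomorphic_on_eval_fps)
    show "ball (0::complex) \<rho> \<subseteq> eball 0 (fps_conv_radius F)"
    proof
      fix z :: complex assume "z \<in> ball 0 \<rho>"
      then have "ereal (dist 0 z) < ereal \<rho>" by simp
      also note cr
      finally show "z \<in> eball 0 (fps_conv_radius F)"
        by (simp only: eball_def mem_Collect_eq)
    qed
  qed
  have "0 < ereal \<rho>" using \<rho> by simp
  then have "fps_conv_radius F > 0" using cr by (rule less_le_trans)
  then have "eval_fps F has_fps_expansion F"
    by (rule eval_fps_has_fps_expansion)
  then have dg: "(deriv ^^ k) (eval_fps F) 0 = fact k * \<kappa> k" for k
    using fps_nth_fps_expansion[of "eval_fps F" F k] by (simp add: F_def field_simps)
  show ?thesis
  proof (rule that[of \<rho> "eval_fps F"])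
    show "f (complex_of_real x) = exp (eval_fps F (complex_of_real x))" if "\<bar>x\<bar> < \<rho>" for x
      using f[of x] that \<rho> by (simp add: F_def eval_fps_def)
  qed (use \<rho> hol dg in auto)
qed

text \<open>The equation \<open>f = exp g\<close> extends from a real neighbourhood of \<open>0\<close> to a complex one by the identity theorem.\<close>

lemma log_coeffs_higher_deriv_recurrence:
  assumes f: "f holomorphic_on S" "open S" "0 \<in> S" and "log_coeffs f \<kappa>"
  shows "f 0 = exp (\<kappa> 0)"
    and "(deriv ^^ Suc n) f 0 =
      (\<Sum>i=0..n. of_nat (n choose i) * (fact (Suc i) * \<kappa> (Suc i)) * (deriv ^^ (n - i)) f 0)"
proof -
  obtain \<rho> g where \<rho>: "\<rho> > 0" and g: "g holomorphic_on ball 0 \<rho>"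
    and eq: "\<And>x::real. \<bar>x\<bar> < \<rho> \<Longrightarrow> f (of_real x) = exp (g (of_real x))"
    and dg: "\<And>k. (deriv ^^ k) g 0 = fact k * \<kappa> k"
    using log_coeffsE[OF assms(4)] by metis
  obtain \<rho>' where \<rho>': "\<rho>' > 0" "ball 0 \<rho>' \<subseteq> S"
    using openE[OF f(2,3)] by blast
  define r where "r = min \<rho> \<rho>'"
  have r: "r > 0" "r \<le> \<rho>" "r \<le> \<rho>'"
    using \<rho> \<rho>'(1) by (simp_all add: r_def)
  have sub: "ball 0 r \<subseteq> S" "ball (0::complex) r \<subseteq> ball 0 \<rho>"
    by (rule subset_trans[OF subset_ball[OF r(3)] \<rho>'(2)], rule subset_ball[OF r(2)])
  have hol: "f holomorphic_on ball 0 r" "g holomorphic_on ball 0 r"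
    by (rule holomorphic_on_subset[OF f(1) sub(1)], rule holomorphic_on_subset[OF g sub(2)])
  define U where "U = complex_of_real ` {-r<..<r}"
  have "f w - exp (g w) = 0" if w: "w \<in> ball 0 r" for w
  proof (rule analytic_continuation[where f = "\<lambda>z. f z - exp (g z)" and S = "ball 0 r" and U = U and \<xi> = 0])
    show "(\<lambda>z. f z - exp (g z)) holomorphic_on ball 0 r"
      using hol by (intro holomorphic_intros)
    show "0 islimpt U"
    proof (rule islimptI)
      fix T :: "complex set" assume "0 \<in> T" "open T"
      from this(2,1) obtain e where e: "e > 0" "ball 0 e \<subseteq> T"
        by (rule openE)
      define x where "x = min e r / 2"
      have x: "0 < x" "x < e" "x < r"
        using e r by (auto simp: x_def)
      then have "complex_of_real x \<in> U" "complex_of_real x \<noteq> 0"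
        by (auto simp: U_def)
      moreover have "complex_of_real x \<in> T"
        using x by (intro subsetD[OF e(2)]) simp
      ultimately show "\<exists>y\<in>U. y \<in> T \<and> y \<noteq> 0"
        by blast
    qed
    show "f z - exp (g z) = 0" if zU: "z \<in> U" for z
      proof -
      obtain x where "z = of_real x" "\<bar>x\<bar> < \<rho>"
        using zU r by (auto simp: U_def)
      then show ?thesis
        using eq[of x] by simp
    qed
    show "U \<subseteq> ball 0 r" by (auto simp: U_def)
  qed (use w r in simp_all)
  then have *: "\<And>w. w \<in> ball 0 r \<Longrightarrow> f w = exp (g w)"
    by simp
  show "f 0 = exp (\<kappa> 0)"
    using *[of 0] r dg[of 0] by simp
  have "(deriv ^^ Suc n) f 0 =
      (\<Sum>i=0..n. of_nat (n choose i) * (deriv ^^ Suc i) g 0 * (deriv ^^ (n - i)) f 0)"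
    using r by (intro higher_deriv_exp_recurrence[OF open_ball hol _ *]) simp_all
  then show "(deriv ^^ Suc n) f 0 =
      (\<Sum>i=0..n. of_nat (n choose i) * (fact (Suc i) * \<kappa> (Suc i)) * (deriv ^^ (n - i)) f 0)"
    unfolding dg .
qed

text \<open>The radii hidden in \<open>log_coeffs (f n) (\<kappa> n)\<close> may shrink with \<open>n\<close>; the recurrence for the derivatives at \<open>0\<close> does not see
  them.\<close>

lemma log_coeffs_tendsto_higher_deriv:
  assumes S: "open S" "0 \<in> S" and f: "\<And>n::nat. f n holomorphic_on S" and g: "g holomorphic_on S"
    and "\<And>n. log_coeffs (f n) (\<kappa> n)" "log_coeffs g \<nu>" and lim: "\<And>k. (\<lambda>n. \<kappa> n k) \<longlonglongrightarrow> \<nu> k"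
  shows "(\<lambda>n. (deriv ^^ k) (f n) 0) \<longlonglongrightarrow> (deriv ^^ k) g 0"
proof (induction k rule: less_induct)
  case (less k)
  show ?case
  proof (cases k)
    case 0
    have "(\<lambda>n. exp (\<kappa> n 0)) \<longlonglongrightarrow> exp (\<nu> 0)"
      using lim by (intro tendsto_intros)
    then show ?thesis
      using log_coeffs_higher_deriv_recurrence(1)[OF f S assms(5)]
        log_coeffs_higher_deriv_recurrence(1)[OF g S assms(6)] 0 by simp
  next
    case (Suc m)
    have "(\<lambda>n. (deriv ^^ (m - i)) (f n) 0) \<longlonglongrightarrow> (deriv ^^ (m - i)) g 0" for i
      using less.IH[of "m - i"] Suc by simp
    then have "(\<lambda>n. \<Sum>i=0..m. of_nat (m choose i) * (fact (Suc i) * \<kappa> n (Suc i)) * (deriv ^^ (m - i)) (f n) 0)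
      \<longlonglongrightarrow> (\<Sum>i=0..m. of_nat (m choose i) * (fact (Suc i) * \<nu> (Suc i)) * (deriv ^^ (m - i)) g 0)"
      by (intro tendsto_sum tendsto_mult tendsto_const lim)
    then show ?thesis
      by (simp only: Suc log_coeffs_higher_deriv_recurrence(2)[OF f S assms(5)]
        log_coeffs_higher_deriv_recurrence(2)[OF g S assms(6)])
  qed
qed


section \<open>Exponential moments and characteristic functions on a strip\<close>

definition complex_char :: "real measure \<Rightarrow> complex \<Rightarrow> complex" where
  "complex_char \<nu> z = (\<integral>x. exp (\<i> * z * of_real x) \<partial>\<nu>)"

lemma char_eq_complex_char: "char \<nu> t = complex_char \<nu> (of_real t)"
  by (simp add: char_def complex_char_def mult_ac)

lemma norm_exp_i_times_le: "norm (exp (\<i> * z * of_real x)) \<le> exp (\<bar>Im z\<bar> * \<bar>x\<bar>)"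
proof -
  have "- (Im z * x) \<le> \<bar>Im z\<bar> * \<bar>x\<bar>"
    by (metis abs_ge_minus_self abs_mult)
  then show ?thesis
    by (simp add: norm_exp_eq_Re)
qed

context
  fixes \<nu> :: "real measure" and c :: real
  assumes \<nu>: "real_distribution \<nu>" and c: "c > 0"
    and int: "integrable \<nu> (\<lambda>x. exp (c * \<bar>x\<bar>))"
begin

interpretation real_distribution \<nu> by (rule \<nu>)

lemma norm_complex_char_le:
  assumes "\<bar>Im z\<bar> \<le> c"
  shows "norm (complex_char \<nu> z) \<le> (\<integral>x. exp (c * \<bar>x\<bar>) \<partial>\<nu>)"
proof -
  have le: "norm (exp (\<i> * z * of_real x)) \<le> exp (c * \<bar>x\<bar>)" for x :: real
    using assms by (intro order_trans[OF norm_exp_i_times_le]) (auto intro!: mult_right_mono)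
  have "integrable \<nu> (\<lambda>x. exp (\<i> * z * of_real x))"
    by (rule Bochner_Integration.integrable_bound[OF int]) (use le in auto)
  then have "norm (complex_char \<nu> z) \<le> (\<integral>x. norm (exp (\<i> * z * of_real x)) \<partial>\<nu>)"
    by (auto simp only: complex_char_def intro: integral_norm_bound)
  also have "\<dots> \<le> (\<integral>x. exp (c * \<bar>x\<bar>) \<partial>\<nu>)"
    using int by (intro integral_mono le integrable_norm \<open>integrable \<nu> (\<lambda>x. exp (\<i> * z * of_real x))\<close>)
  finally show ?thesis .
qed

text \<open>Around each real \<open>t\<close> the exponential series may be integrated termwise, because it is dominated by \<open>exp (c \<bar>x\<bar>)\<close>
  as long as the distance to \<open>t\<close> is less than \<open>c\<close>. The discs of radius \<open>c\<close> with real centres cover the strip.\<close>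

lemma complex_char_holomorphic: "complex_char \<nu> holomorphic_on {z. \<bar>Im z\<bar> < c}"
proof -
  have ball: "complex_char \<nu> holomorphic_on ball (of_real t) c" for t :: real
  proof (rule power_series_holomorphic)
    fix w assume "w \<in> ball (complex_of_real t) c"
    define r where "r = norm (w - of_real t)"
    have r: "0 \<le> r" "r < c"
      using \<open>w \<in> _\<close> by (auto simp: r_def dist_norm norm_minus_commute)
    define f where "f = (\<lambda>n x. exp (\<i> * of_real t * of_real x) * (\<i> * of_real x) ^ n / fact n * (w - of_real t) ^ n :: complex)"
    have norm_f: "norm (f n x) = (r * \<bar>x\<bar>) ^ n / fact n" for n x
      by (simp add: f_def norm_mult norm_divide norm_power norm_exp_eq_Re r_def power_mult_distrib mult_ac)
    have sums_norm: "(\<lambda>n. norm (f n x)) sums exp (r * \<bar>x\<bar>)" for x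
      unfolding norm_f using exp_converges[of "r * \<bar>x\<bar>"] by (simp add: field_simps)
    have part: "(\<Sum>n<N. norm (f n x)) \<le> exp (c * \<bar>x\<bar>)" for N x
    proof -
      have "(\<Sum>n<N. norm (f n x)) \<le> (\<Sum>n. norm (f n x))"
        using sums_norm[of x] by (intro sum_le_suminf) (auto simp: sums_iff)
      also have "\<dots> = exp (r * \<bar>x\<bar>)"
        using sums_norm[of x] by (simp add: sums_iff)
      also have "\<dots> \<le> exp (c * \<bar>x\<bar>)"
        using r by (auto intro: mult_right_mono)
      finally show ?thesis .
    qed
    have meas: "f n \<in> borel_measurable \<nu>" for n
      unfolding f_def by measurable
    have f_le: "norm (f n x) \<le> norm (exp (c * \<bar>x\<bar>))" for n x
      using part[of x "Suc n"] sum_nonneg[of "{..<n}" "\<lambda>n. norm (f n x)"] by simp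
    have f_int: "integrable \<nu> (f n)" for n
      by (rule Bochner_Integration.integrable_bound[OF int meas]) (use f_le in auto)
    have "(\<lambda>n. \<integral>x. f n x \<partial>\<nu>) sums (\<integral>x. (\<Sum>n. f n x) \<partial>\<nu>)"
    proof (rule sums_integral[OF f_int])
      show "AE x in \<nu>. summable (\<lambda>n. norm (f n x))"
        using sums_norm by (auto simp: sums_iff)
      show "summable (\<lambda>n. \<integral>x. norm (f n x) \<partial>\<nu>)"
      proof (rule summableI_nonneg_bounded)
        fix N
        have "(\<Sum>n<N. \<integral>x. norm (f n x) \<partial>\<nu>) = (\<integral>x. (\<Sum>n<N. norm (f n x)) \<partial>\<nu>)"
          using f_int by (subst Bochner_Integration.integral_sum) auto
        also have "\<dots> \<le> (\<integral>x. exp (c * \<bar>x\<bar>) \<partial>\<nu>)"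
          using f_int part int by (intro integral_mono) auto
        finally show "(\<Sum>n<N. \<integral>x. norm (f n x) \<partial>\<nu>) \<le> (\<integral>x. exp (c * \<bar>x\<bar>) \<partial>\<nu>)" .
      qed auto
    qed
    moreover have "(\<Sum>n. f n x) = exp (\<i> * w * of_real x)" for x
    proof -
      have "(\<lambda>n. exp (\<i> * of_real t * of_real x) * ((\<i> * of_real x * (w - of_real t)) ^ n /\<^sub>R fact n))
        sums (exp (\<i> * of_real t * of_real x) * exp (\<i> * of_real x * (w - of_real t)))"
        by (intro sums_mult exp_converges)
      also have "(\<lambda>n. exp (\<i> * of_real t * of_real x) * ((\<i> * of_real x * (w - of_real t)) ^ n /\<^sub>R fact n))
        = (\<lambda>n. f n x)"
        by (simp add: f_def fun_eq_iff power_mult_distrib scaleR_conv_of_real divide_inverse mult_ac)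
      also have "exp (\<i> * of_real t * of_real x) * exp (\<i> * of_real x * (w - of_real t)) = exp (\<i> * w * of_real x)"
        by (simp add: exp_add[symmetric] algebra_simps)
      finally show ?thesis
        by (simp add: sums_iff)
    qed
    ultimately show "(\<lambda>n. (\<integral>x. exp (\<i> * of_real t * of_real x) * (\<i> * of_real x) ^ n / fact n \<partial>\<nu>) *
        (w - of_real t) ^ n) sums complex_char \<nu> w"
      by (simp add: f_def complex_char_def)
  qed
  have "complex_char \<nu> holomorphic_on (\<Union>t. ball (complex_of_real t) c)"
    using ball by (intro holomorphic_on_UN_open) auto
  moreover have "{z. \<bar>Im z\<bar> < c} \<subseteq> (\<Union>t. ball (complex_of_real t) c)"
  proof
    fix z assume "z \<in> {z. \<bar>Im z\<bar> < c}"
    moreover have "dist (complex_of_real (Re z)) z = \<bar>Im z\<bar>"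
      by (simp add: dist_norm cmod_def)
    ultimately show "z \<in> (\<Union>t. ball (complex_of_real t) c)"
      by (metis UN_I UNIV_I mem_Collect_eq mem_ball)
  qed
  ultimately show ?thesis
    by (rule holomorphic_on_subset)
qed

end

text \<open>Applied \<open>m\<close> times to a characteristic function, this difference operator produces the factor \<open>(2 \<i> sin (h x))\<^sup>m\<close> under the
  integral. Unlike a derivative, it can be taken under the integral before any moment is known to exist.\<close>

definition central_diff :: "real \<Rightarrow> (complex \<Rightarrow> complex) \<Rightarrow> complex \<Rightarrow> complex" where
  "central_diff h f z = f (z + of_real h) - f (z - of_real h)"

text \<open>Each difference costs a factor \<open>2 h / \<delta>\<close>, by Cauchy's estimate for the derivative, and shrinks the disc by \<open>2 \<delta>\<close>:
  once by \<open>\<delta>\<close> for Cauchy's estimate and once by \<open>h \<le> \<delta>\<close> for the translations.\<close>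

lemma norm_central_diff_power_le:
  assumes "0 < h" "h \<le> \<delta>"
  assumes "f holomorphic_on ball 0 \<rho>" "\<And>z. norm z < \<rho> \<Longrightarrow> norm (f z) \<le> K"
    and "norm z < \<rho> - 2 * real m * \<delta>"
  shows "norm ((central_diff h ^^ m) f z) \<le> (2 * h / \<delta>) ^ m * K"
  using assms(3-)
proof (induction m arbitrary: f \<rho> K)
  case 0
  then show ?case by simp
next
  case (Suc m)
  have \<delta>: "\<delta> > 0"
    using assms by linarith
  have sub: "ball 0 (\<rho> - \<delta>) \<subseteq> ball (0::complex) \<rho>"
    using \<delta> by (intro subset_ball) simp
  have dB: "norm (deriv f w) \<le> K / \<delta>" if w: "w \<in> ball 0 (\<rho> - \<delta>)" for w
  proof -
    have cb: "norm v < \<rho>" if "v \<in> cball w \<delta>" for v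
    proof -
      have "norm v \<le> norm w + norm (v - w)"
        using norm_triangle_ineq[of w "v - w"] by simp
      then show ?thesis
        using that w by (simp add: dist_norm norm_minus_commute)
    qed
    then have sub': "cball w \<delta> \<subseteq> ball 0 \<rho>"
      by (auto simp only: mem_ball dist_0_norm)
    have "norm ((deriv ^^ 1) f w) \<le> fact 1 * K / \<delta> ^ 1"
    proof (rule Cauchy_inequality)
      show "f holomorphic_on ball w \<delta>"
        by (rule holomorphic_on_subset[OF Suc.prems(1)]) (use sub' ball_subset_cball in fast)
      show "continuous_on (cball w \<delta>) f"
        by (rule continuous_on_subset[OF holomorphic_on_imp_continuous_on[OF Suc.prems(1)] sub'])
      show "norm (f v) \<le> K" if "norm (w - v) = \<delta>" for v
        using that by (intro Suc.prems(2) cb) (simp add: dist_norm)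
    qed (rule \<delta>)
    then show ?thesis by simp
  qed
  have "norm (central_diff h f v) \<le> 2 * h / \<delta> * K" if v: "norm v < \<rho> - 2 * \<delta>" for v
  proof -
    have "norm (v + of_real h) \<le> norm v + h" "norm (v - of_real h) \<le> norm v + h"
      using norm_triangle_ineq[of v "of_real h"] norm_triangle_ineq4[of v "of_real h"] assms by simp_all
    then have in_ball: "v + of_real h \<in> ball 0 (\<rho> - \<delta>)" "v - of_real h \<in> ball 0 (\<rho> - \<delta>)"
      using v assms by simp_all
    have "norm (f (v + of_real h) - f (v - of_real h)) \<le> K / \<delta> * norm ((v + of_real h) - (v - of_real h))"
    proof (rule field_differentiable_bound[OF convex_ball _ dB in_ball])
      show "(f has_field_derivative deriv f w) (at w within ball 0 (\<rho> - \<delta>))"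
        if "w \<in> ball 0 (\<rho> - \<delta>)" for w
        using holomorphic_derivI[OF Suc.prems(1) open_ball] that sub
        by (auto intro: has_field_derivative_at_within)
    qed
    also have "(v + of_real h) - (v - of_real h) = of_real (2 * h)"
      by simp
    finally show ?thesis
      using assms(1) by (simp add: central_diff_def norm_mult mult_ac)
  qed
  moreover have "central_diff h f holomorphic_on ball 0 (\<rho> - 2 * \<delta>)"
  proof -
    have *: "(\<lambda>z. f (z + of_real a)) holomorphic_on ball 0 (\<rho> - 2 * \<delta>)" if "\<bar>a\<bar> \<le> \<delta>" for a :: real
    proof -
      have "f \<circ> (\<lambda>z. z + of_real a) holomorphic_on ball 0 (\<rho> - 2 * \<delta>)"
      proof (rule holomorphic_on_compose_gen[OF _ Suc.prems(1)])
        show "(\<lambda>z. z + complex_of_real a) ` ball 0 (\<rho> - 2 * \<delta>) \<subseteq> ball 0 \<rho>"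
        proof
          fix y assume "y \<in> (\<lambda>z. z + complex_of_real a) ` ball 0 (\<rho> - 2 * \<delta>)"
          then obtain x where "y = x + of_real a" "norm x < \<rho> - 2 * \<delta>"
            by (auto simp only: mem_ball dist_0_norm)
          then show "y \<in> ball 0 \<rho>"
            using norm_triangle_ineq[of x "of_real a"] that \<delta> by simp
        qed
      qed (intro holomorphic_intros)
      then show ?thesis by (simp add: o_def)
    qed
    have "(\<lambda>z. f (z + of_real h) - f (z + of_real (- h))) holomorphic_on ball 0 (\<rho> - 2 * \<delta>)"
      using assms by (intro holomorphic_intros *) auto
    then show ?thesis
      by (simp add: central_diff_def[abs_def])
  qed
  moreover have "norm z < \<rho> - 2 * \<delta> - 2 * real m * \<delta>"
    using Suc.prems(3) by (simp add: algebra_simps)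
  ultimately have "norm ((central_diff h ^^ m) (central_diff h f) z) \<le> (2 * h / \<delta>) ^ m * (2 * h / \<delta> * K)"
    by (intro Suc.IH)
  then show ?case
    by (simp only: funpow_Suc_right o_def power_Suc mult_ac)
qed

lemma (in real_distribution) central_diff_power_char:
  assumes F: "\<And>t. \<bar>t\<bar> < \<rho> \<Longrightarrow> char M t = F (of_real t)" and h: "h > 0"
    and "\<bar>t\<bar> + real m * h < \<rho>"
  shows "(central_diff h ^^ m) F (of_real t) = (\<integral>x. (2 * \<i> * of_real (sin (h * x))) ^ m * iexp (t * x) \<partial>M)"
  using assms(3)
proof (induction m arbitrary: t)
  case 0
  then show ?case
    using F[of t] by (simp add: char_def)
next
  case (Suc m)
  have int: "integrable M (\<lambda>x. (2 * \<i> * of_real (sin (h * x))) ^ m * iexp (s * x))" for s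
  proof (rule integrable_const_bound[where B = "2 ^ m"])
    have "norm ((2 * \<i> * of_real (sin (h * x))) ^ m * iexp (s * x)) \<le> 2 ^ m" for x
      by (auto simp: norm_mult norm_power power_mult_distrib intro!: power_le_one)
    then show "AE x in M. norm ((2 * \<i> * of_real (sin (h * x))) ^ m * iexp (s * x)) \<le> 2 ^ m"
      by simp
  qed measurable
  have b: "\<bar>t + h\<bar> + real m * h < \<rho>" "\<bar>t - h\<bar> + real m * h < \<rho>"
    using Suc.prems h by (auto simp: algebra_simps)
  have "(central_diff h ^^ Suc m) F (of_real t) =
      (central_diff h ^^ m) F (of_real (t + h)) - (central_diff h ^^ m) F (of_real (t - h))"
    by (simp add: central_diff_def)
  also have "\<dots> = (\<integral>x. (2 * \<i> * of_real (sin (h * x))) ^ m * iexp ((t + h) * x) -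
      (2 * \<i> * of_real (sin (h * x))) ^ m * iexp ((t - h) * x) \<partial>M)"
    unfolding Suc.IH[OF b(1)] Suc.IH[OF b(2)]
    by (rule Bochner_Integration.integral_diff[symmetric]) (rule int)+
  also have "\<dots> = (\<integral>x. (2 * \<i> * of_real (sin (h * x))) ^ Suc m * iexp (t * x) \<partial>M)"
  proof (rule Bochner_Integration.integral_cong[OF refl])
    fix x
    have *: "iexp ((t + h) * x) = iexp (t * x) * iexp (h * x)"
      "iexp ((t - h) * x) = iexp (t * x) * iexp (- (h * x))"
      by (simp_all add: exp_add[symmetric] algebra_simps)
    have "iexp (h * x) - iexp (- (h * x)) = 2 * \<i> * of_real (sin (h * x))"
      by (simp add: complex_eq_iff Re_exp Im_exp)
    then show "(2 * \<i> * of_real (sin (h * x))) ^ m * iexp ((t + h) * x) -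
      (2 * \<i> * of_real (sin (h * x))) ^ m * iexp ((t - h) * x) =
      (2 * \<i> * of_real (sin (h * x))) ^ Suc m * iexp (t * x)"
    proof -
      have alg: "P * (T * A) - P * (T * B) = P * (T * (A - B))" for P T A B :: complex
        by (simp add: algebra_simps)
      show ?thesis
        unfolding * alg \<open>iexp (h * x) - iexp (- (h * x)) = _\<close> by (simp only: power_Suc mult_ac)
    qed
  qed
  finally show ?case .
qed


text \<open>A crude form of Stirling's formula, from a single term of the exponential series. It converts the bound
  \<open>(4 m / \<rho>)\<^sup>m\<close> for the \<open>m\<close>-th moment into a geometric bound after division by \<open>m!\<close>.\<close>

lemma fact_ge_power_exp: "real m ^ m \<le> exp 1 ^ m * fact m"
proof -
  have "real m ^ m /\<^sub>R fact m \<le> (\<Sum>n. real m ^ n /\<^sub>R fact n)"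
    using sum_le_suminf[of "\<lambda>n. real m ^ n /\<^sub>R fact n" "{m}"] exp_converges[of "real m"]
    by (auto simp: sums_iff)
  also have "\<dots> = exp (real m)"
    by (simp add: exp_def)
  also have "\<dots> = exp 1 ^ m"
    using exp_of_nat_mult[of m "1::real"] by simp
  finally show ?thesis
    by (simp add: field_simps)
qed

text \<open>The \<open>m\<close>-th central difference at \<open>0\<close>, divided by \<open>(2 h)\<^sup>m\<close>, is up to a unimodular factor the expectation of \<open>(sin (h x) / h)\<^sup>m\<close>,
  which is nonnegative as \<open>m\<close> is even. The bound by Cauchy's estimates is uniform in \<open>h\<close>, and Fatou's lemma
  yields the moment as \<open>h \<rightarrow> 0\<close>.\<close>

lemma (in real_distribution) even_moment_le:
  assumes F: "F holomorphic_on ball 0 \<rho>" "\<And>z. norm z < \<rho> \<Longrightarrow> norm (F z) \<le> K"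
    and \<rho>: "\<rho> > 0" and char: "\<And>t. \<bar>t\<bar> < \<rho> \<Longrightarrow> char M t = F (of_real t)"
    and m: "even m" "m > 0"
  shows "(\<integral>\<^sup>+x. ennreal (x ^ m) \<partial>M) \<le> ennreal ((4 * real m / \<rho>) ^ m * K)"
proof -
  (* With this choice the m differences use up half of the disc. *)
  define \<delta> where "\<delta> = \<rho> / (4 * real m)"
  have \<delta>: "\<delta> > 0" "2 * real m * \<delta> = \<rho> / 2"
    using \<rho> m by (simp_all add: \<delta>_def field_simps)
  define h where "h = (\<lambda>j. \<delta> / real (Suc j))"
  have h: "h j > 0" "h j \<le> \<delta>" for j
    using \<delta> by (simp_all add: h_def field_simps)
  have h0: "h \<longlonglongrightarrow> 0"
    unfolding h_def by (rule LIMSEQ_Suc[OF lim_const_over_n])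
  have le: "(\<integral>\<^sup>+x. ennreal ((sin (h j * x) / h j) ^ m) \<partial>M) \<le> ennreal ((4 * real m / \<rho>) ^ m * K)" for j
  proof -
    have mh: "real m * h j < \<rho>"
      using mult_left_mono[OF h(2)[of j], of "real m"] \<delta> \<rho> by simp
    have int: "integrable M (\<lambda>x. (2 * sin (h j * x)) ^ m)"
    proof (rule integrable_const_bound[where B = "2 ^ m"])
      have "norm ((2 * sin (h j * x)) ^ m) \<le> 2 ^ m" for x
        by (auto simp: abs_mult norm_power power_mult_distrib power_abs intro!: power_le_one)
      then show "AE x in M. norm ((2 * sin (h j * x)) ^ m) \<le> 2 ^ m"
        by simp
    qed measurable
    have "(central_diff (h j) ^^ m) F (of_real 0) = (\<integral>x. (2 * \<i> * of_real (sin (h j * x))) ^ m * iexp (0 * x) \<partial>M)"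
      using mh h by (intro central_diff_power_char[OF char]) auto
    also have "\<dots> = (\<integral>x. \<i> ^ m * of_real ((2 * sin (h j * x)) ^ m) \<partial>M)"
      by (simp add: power_mult_distrib mult_ac)
    also have "\<dots> = \<i> ^ m * of_real (\<integral>x. (2 * sin (h j * x)) ^ m \<partial>M)"
      by (simp only: integral_mult_right_zero integral_complex_of_real)
    finally have "norm ((central_diff (h j) ^^ m) F 0) = \<bar>\<integral>x. (2 * sin (h j * x)) ^ m \<partial>M\<bar>"
      by (simp add: norm_mult norm_power abs_mult)
    moreover have "norm ((central_diff (h j) ^^ m) F 0) \<le> (2 * h j / \<delta>) ^ m * K"
      using \<delta> \<rho> by (intro norm_central_diff_power_le[OF h F]) auto
    ultimately have "(\<integral>x. (2 * sin (h j * x)) ^ m \<partial>M) \<le> (2 * h j / \<delta>) ^ m * K"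
      by linarith
    then have "(\<integral>x. (2 * sin (h j * x)) ^ m \<partial>M) / (2 * h j) ^ m \<le> (2 * h j / \<delta>) ^ m * K / (2 * h j) ^ m"
      using h(1)[of j] by (intro divide_right_mono) auto
    also have "\<dots> = (1 / \<delta>) ^ m * K"
      using h(1)[of j] by (simp add: power_divide power_mult_distrib)
    also have "(\<integral>x. (2 * sin (h j * x)) ^ m \<partial>M) / (2 * h j) ^ m = (\<integral>x. (sin (h j * x) / h j) ^ m \<partial>M)"
    proof -
      have "(2 * sin (h j * x)) ^ m / (2 * h j) ^ m = (sin (h j * x) / h j) ^ m" for x
        by (simp add: power_divide power_mult_distrib)
      then show ?thesis
        by (simp only: integral_divide_zero[symmetric])
    qed
    finally have "(\<integral>x. (sin (h j * x) / h j) ^ m \<partial>M) \<le> (4 * real m / \<rho>) ^ m * K"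
      using \<rho> m by (simp add: \<delta>_def)
    moreover have "integrable M (\<lambda>x. (sin (h j * x) / h j) ^ m)"
    proof -
      have "integrable M (\<lambda>x. (2 * sin (h j * x)) ^ m / (2 * h j) ^ m)"
        using int by simp
      then show ?thesis
        by (simp add: power_divide power_mult_distrib)
    qed
    ultimately show ?thesis
      using m by (subst nn_integral_eq_integral) (auto simp: zero_le_even_power intro!: ennreal_leI)
  qed
  have lim: "(\<lambda>j. ennreal ((sin (h j * x) / h j) ^ m)) \<longlonglongrightarrow> ennreal (x ^ m)" for x
  proof -
    have "((\<lambda>t. sin (t * x) / t) \<longlongrightarrow> x) (at 0)"
    proof -
      have "((\<lambda>t. sin (t * x)) has_real_derivative x) (at 0)"
        by (auto intro!: derivative_eq_intros)
      then show ?thesis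
        by (simp add: DERIV_def)
    qed
    then have "(\<lambda>j. sin (h j * x) / h j) \<longlonglongrightarrow> x"
      by (rule filterlim_compose) (use h0 h(1) in \<open>auto simp: filterlim_at intro!: always_eventually less_imp_neq[symmetric]\<close>)
    then show ?thesis
      by (intro tendsto_ennrealI tendsto_intros)
  qed
  have "(\<integral>\<^sup>+x. ennreal (x ^ m) \<partial>M) = (\<integral>\<^sup>+x. liminf (\<lambda>j. ennreal ((sin (h j * x) / h j) ^ m)) \<partial>M)"
    by (intro nn_integral_cong lim_imp_Liminf[symmetric] lim) simp
  also have "\<dots> \<le> liminf (\<lambda>j. \<integral>\<^sup>+x. ennreal ((sin (h j * x) / h j) ^ m) \<partial>M)"
    by (intro nn_integral_liminf) measurable
  also have "\<dots> \<le> ennreal ((4 * real m / \<rho>) ^ m * K)"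
    using le by (intro Liminf_le) auto
  finally show ?thesis .
qed

text \<open>Summing the even moments against \<open>c\<^sup>m / m!\<close> gives the expectation of \<open>cosh (c x)\<close>.\<close>

lemma (in real_distribution) exponential_moment:
  assumes F: "F holomorphic_on ball 0 \<rho>" and \<rho>: "\<rho> > 0"
    and char: "\<And>t. \<bar>t\<bar> < \<rho> \<Longrightarrow> char M t = F (of_real t)"
  shows "\<exists>c>0. integrable M (\<lambda>x. exp (c * \<bar>x\<bar>))"
proof -
  define r where "r = \<rho> / 2"
  have r: "r > 0" "r < \<rho>"
    using \<rho> by (simp_all add: r_def)
  have "cball (0::complex) r \<subseteq> ball 0 \<rho>"
    using r by (intro cball_subset_ball_iff[THEN iffD2]) simp
  then have "compact (F ` cball 0 r)"
    by (intro compact_continuous_image holomorphic_on_imp_continuous_on[OF holomorphic_on_subset[OF F]]) auto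
  then obtain K where "\<forall>z\<in>cball 0 r. norm (F z) \<le> K"
    by (auto dest!: compact_imp_bounded simp: bounded_iff)
  then have K: "norm (F z) \<le> K" if "norm z \<le> r" for z
    using that by (simp add: dist_norm)
  have "norm (F 0) = 1"
    using char[of 0] char_zero \<rho> by simp
  then have K1: "K \<ge> 1"
    using K[of 0] r by simp
  have "ball (0::complex) r \<subseteq> ball 0 \<rho>"
    using r by (intro subset_ball) simp
  then have F': "F holomorphic_on ball 0 r"
    by (rule holomorphic_on_subset[OF F])
  (* The m-th term of the sum is at most K (4 c e / r)^m, so this c gives the ratio 1/2. *)
  define c where "c = r / (8 * exp 1)"
  have c: "c > 0"
    using r by (simp add: c_def)
  define f where "f = (\<lambda>n x. if even n then (c * x) ^ n / fact n else 0 :: real)"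
  have f0: "f n x \<ge> 0" for n x
    by (simp add: f_def zero_le_even_power)
  have f_le: "(\<integral>\<^sup>+x. ennreal (f n x) \<partial>M) \<le> ennreal (K * (1 / 2) ^ n)" for n
  proof (cases "even n \<and> n > 0")
    case True
    have "(\<integral>\<^sup>+x. ennreal (f n x) \<partial>M) = (\<integral>\<^sup>+x. ennreal (c ^ n / fact n) * ennreal (x ^ n) \<partial>M)"
      using True c by (intro nn_integral_cong) (simp add: f_def power_mult_distrib ennreal_mult[symmetric] zero_le_even_power)
    also have "\<dots> = ennreal (c ^ n / fact n) * (\<integral>\<^sup>+x. ennreal (x ^ n) \<partial>M)"
      by (intro nn_integral_cmult) measurable
    also have "\<dots> \<le> ennreal (c ^ n / fact n) * ennreal ((4 * real n / r) ^ n * K)"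
      using True r K by (intro mult_left_mono even_moment_le[OF F' _ _ char]) auto
    also have "\<dots> = ennreal (c ^ n / fact n * ((4 * real n / r) ^ n * K))"
      using c r K1 by (intro ennreal_mult[symmetric]) auto
    also have "\<dots> \<le> ennreal (K * (1 / 2) ^ n)"
    proof (rule ennreal_leI)
      have "c ^ n / fact n * ((4 * real n / r) ^ n * K) = (4 * c / r) ^ n * K * (real n ^ n / fact n)"
        by (simp add: power_mult_distrib power_divide mult_ac)
      also have "\<dots> \<le> (4 * c / r) ^ n * K * exp 1 ^ n"
        using fact_ge_power_exp[of n] c r K1 by (intro mult_left_mono) (auto simp: field_simps)
      also have "\<dots> = K * (4 * c / r * exp 1) ^ n"
        by (simp only: power_mult_distrib mult_ac)
      also have "4 * c / r * exp 1 = 1 / 2"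
        using r by (simp add: c_def)
      finally show "c ^ n / fact n * ((4 * real n / r) ^ n * K) \<le> K * (1 / 2) ^ n" .
    qed
    finally show ?thesis .
  next
    case False
    then consider "n = 0" | "odd n" by auto
    then show ?thesis
    proof cases
      case 1
      then show ?thesis
        using K1 emeasure_space_1 by (simp add: f_def flip: space_eq_univ)
    next
      case 2
      then show ?thesis by (simp add: f_def)
    qed
  qed
  have cosh: "(\<lambda>n. f n x) sums cosh (c * x)" for x
  proof -
    have "(\<lambda>n. f n x) = (\<lambda>n. if even n then (c * x) ^ n /\<^sub>R fact n else 0)"
      by (simp add: f_def fun_eq_iff divide_inverse mult.commute)
    then show ?thesis
      using cosh_converges[of "c * x"] by (simp only:)
  qed
  have "(\<integral>\<^sup>+x. ennreal (cosh (c * x)) \<partial>M) = (\<integral>\<^sup>+x. (\<Sum>n. ennreal (f n x)) \<partial>M)"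
    using cosh f0 by (intro nn_integral_cong) (simp add: suminf_ennreal2 sums_iff)
  also have "\<dots> = (\<Sum>n. \<integral>\<^sup>+x. ennreal (f n x) \<partial>M)"
    unfolding f_def by (intro nn_integral_suminf) measurable
  also have "\<dots> \<le> (\<Sum>n. ennreal (K * (1 / 2) ^ n))"
    by (intro suminf_le f_le) auto
  also have "\<dots> < \<infinity>"
    using K1 by (subst suminf_ennreal2) (auto intro!: summable_mult summable_geometric)
  finally have fin: "(\<integral>\<^sup>+x. ennreal (cosh (c * x)) \<partial>M) < \<infinity>" .
  have "integrable M (\<lambda>x. cosh (c * x))"
    using fin by (intro integrableI_nonneg) (auto simp: cosh_def)
  then have "integrable M (\<lambda>x. 2 * cosh (c * x))"
    by simp
  then have "integrable M (\<lambda>x. exp (c * \<bar>x\<bar>))"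
  proof (rule Bochner_Integration.integrable_bound)
    have "norm (exp (c * \<bar>x\<bar>)) \<le> norm (2 * cosh (c * x))" for x
      by (cases "x \<ge> 0") (auto simp: cosh_def)
    then show "AE x in M. norm (exp (c * \<bar>x\<bar>)) \<le> norm (2 * cosh (c * x))"
      by simp
  qed measurable
  then show ?thesis
    using c by auto
qed


section \<open>Laws determined by the logarithm of the characteristic function near the origin\<close>

lemma exp_moment_mono:
  assumes "real_distribution \<nu>" "integrable \<nu> (\<lambda>x. exp (c * \<bar>x\<bar>))" "c' \<le> c"
  shows "integrable \<nu> (\<lambda>x. exp (c' * \<bar>x\<bar>))"
proof -
  interpret real_distribution \<nu> by fact
  show ?thesis
  proof (rule Bochner_Integration.integrable_bound[OF assms(2)])
    show "AE x in \<nu>. norm (exp (c' * \<bar>x\<bar>)) \<le> norm (exp (c * \<bar>x\<bar>))"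
      using assms(3) by (auto intro!: always_eventually mult_right_mono)
  qed measurable
qed

text \<open>Convergence of the coefficients at the single point \<open>0\<close> suffices, since the exponential moments extend all the
  characteristic functions to one strip with one bound.\<close>

lemma char_tendsto_if_log_coeffs_tendsto:
  fixes \<nu> :: "nat \<Rightarrow> real measure"
  assumes \<nu>: "\<And>n. real_distribution (\<nu> n)" and \<nu>': "real_distribution \<nu>'" and c: "c > 0"
    and int: "\<And>n. integrable (\<nu> n) (\<lambda>x. exp (c * \<bar>x\<bar>))" and int': "integrable \<nu>' (\<lambda>x. exp (c * \<bar>x\<bar>))"
    and B: "\<And>n. (\<integral>x. exp (c * \<bar>x\<bar>) \<partial>\<nu> n) \<le> B"
    and \<kappa>: "\<And>n. log_coeffs (complex_char (\<nu> n)) (\<kappa> n)" and \<kappa>': "log_coeffs (complex_char \<nu>') \<kappa>'"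
    and lim: "\<And>k. (\<lambda>n. \<kappa> n k) \<longlonglongrightarrow> \<kappa>' k"
  shows "(\<lambda>n. char (\<nu> n) t) \<longlonglongrightarrow> char \<nu>' t"
proof -
  define S where "S = {z. \<bar>Im z\<bar> < c}"
  have S: "S = {z. - c < Im z} \<inter> {z. Im z < c}"
    by (auto simp: S_def)
  have "open S"
    unfolding S by (intro open_Int open_halfspace_Im_gt open_halfspace_Im_lt)
  moreover have "connected S"
    unfolding S by (intro convex_connected convex_Int convex_halfspace_Im_gt convex_halfspace_Im_lt)
  moreover have zero: "0 \<in> S" and t: "of_real t \<in> S"
    using c by (simp_all add: S_def)
  moreover have hol: "complex_char (\<nu> n) holomorphic_on S" for n
    unfolding S_def by (rule complex_char_holomorphic[OF \<nu> c int])
  moreover have hol': "complex_char \<nu>' holomorphic_on S"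
    unfolding S_def by (rule complex_char_holomorphic[OF \<nu>' c int'])
  moreover have "norm (complex_char (\<nu> n) v) \<le> B" if "v \<in> S" for n v
    using that by (intro order_trans[OF norm_complex_char_le[OF \<nu> c int] B]) (simp add: S_def)
  moreover have "(\<lambda>n. (deriv ^^ k) (complex_char (\<nu> n)) 0) \<longlonglongrightarrow> (deriv ^^ k) (complex_char \<nu>') 0" for k
    by (rule log_coeffs_tendsto_higher_deriv[OF \<open>open S\<close> zero hol hol' \<kappa> \<kappa>' lim])
  ultimately have "(\<lambda>n. complex_char (\<nu> n) (of_real t)) \<longlonglongrightarrow> complex_char \<nu>' (of_real t)"
    by (rule bounded_holomorphic_seq_tendsto)
  then show ?thesis
    by (simp add: char_eq_complex_char)
qed

lemma log_coeffs_exponential_moment: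
  assumes "real_distribution \<nu>" "log_coeffs (complex_char \<nu>) \<kappa>"
  shows "\<exists>c>0. integrable \<nu> (\<lambda>x. exp (c * \<bar>x\<bar>))"
proof -
  interpret real_distribution \<nu> by fact
  show ?thesis
  proof (rule log_coeffsE[OF assms(2)])
    fix \<rho> :: real and g
    assume *: "\<rho> > 0" "g holomorphic_on ball 0 \<rho>"
      "\<And>x::real. \<bar>x\<bar> < \<rho> \<Longrightarrow> complex_char \<nu> (of_real x) = exp (g (of_real x))"
    show ?thesis
    proof (rule exponential_moment[of "\<lambda>z. exp (g z)"])
      show "(\<lambda>z. exp (g z)) holomorphic_on ball 0 \<rho>"
        by (intro holomorphic_intros *)
    qed (simp_all add: char_eq_complex_char *)
  qed
qed

text \<open>The limit theorem applied to a constant sequence identifies the characteristic functions everywhere.\<close>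

lemma log_coeffs_unique:
  assumes "real_distribution \<nu>" "real_distribution \<nu>'"
    and "log_coeffs (complex_char \<nu>) \<kappa>" "log_coeffs (complex_char \<nu>') \<kappa>"
  shows "\<nu> = \<nu>'"
proof (rule Levy_uniqueness[OF assms(1,2)])
  obtain c where c: "c > 0" "integrable \<nu> (\<lambda>x. exp (c * \<bar>x\<bar>))"
    using log_coeffs_exponential_moment[OF assms(1,3)] by auto
  obtain c' where c': "c' > 0" "integrable \<nu>' (\<lambda>x. exp (c' * \<bar>x\<bar>))"
    using log_coeffs_exponential_moment[OF assms(2,4)] by auto
  show "char \<nu> = char \<nu>'"
  proof
    fix t
    have "(\<lambda>n::nat. char \<nu> t) \<longlonglongrightarrow> char \<nu>' t"
      by (rule char_tendsto_if_log_coeffs_tendsto[where c = "min c c'" and \<kappa> = "\<lambda>n. \<kappa>" and \<kappa>' = \<kappa>])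
        (use assms c c' in \<open>auto intro: exp_moment_mono\<close>)
    then show "char \<nu> t = char \<nu>' t"
      by (simp add: LIMSEQ_const_iff)
  qed
qed

section \<open>Weak convergence in the plane from characteristic functions\<close>

inductive trig_poly :: "(real \<times> real \<Rightarrow> complex) \<Rightarrow> bool" where
  character: "trig_poly (\<lambda>p. iexp (u * fst p + v * snd p))"
| cmult: "trig_poly f \<Longrightarrow> trig_poly (\<lambda>p. c * f p)"
| add: "trig_poly f \<Longrightarrow> trig_poly g \<Longrightarrow> trig_poly (\<lambda>p. f p + g p)"

lemma trig_poly_const: "trig_poly (\<lambda>p. c)"
  using trig_poly.cmult[OF trig_poly.character[of 0 0], of c] by simp

lemma trig_poly_mult:
  assumes "trig_poly f" "trig_poly g"
  shows "trig_poly (\<lambda>p. f p * g p)"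
  using assms(1)
proof (induction rule: trig_poly.induct)
  case (character u v)
  show ?case
    using assms(2)
  proof (induction rule: trig_poly.induct)
    case (character u' v')
    have "iexp (u * fst p + v * snd p) * iexp (u' * fst p + v' * snd p) =
        iexp ((u + u') * fst p + (v + v') * snd p)" for p
      by (simp add: exp_add[symmetric] algebra_simps)
    then show ?case
      using trig_poly.character[of "u + u'" "v + v'"] by simp
  next
    case (cmult f c)
    then show ?case
      using trig_poly.cmult[OF cmult.IH, of c] by (simp add: mult_ac)
  next
    case (add f g)
    then show ?case
      using trig_poly.add[OF add.IH] by (simp add: algebra_simps)
  qed
next
  case (cmult f c)
  then show ?case
    using trig_poly.cmult[OF cmult.IH, of c] by (simp add: mult_ac)
next
  case (add f g)
  then show ?case
    using trig_poly.add[OF add.IH] by (simp add: algebra_simps)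
qed

lemma trig_poly_sin: "trig_poly (\<lambda>p. of_real (sin (u * fst p + v * snd p)))"
proof -
  have sin: "complex_of_real (sin w) = 1 / (2 * \<i>) * iexp w + (- 1 / (2 * \<i>)) * iexp (- w)" for w
  proof -
    have "complex_of_real (sin w) = (exp (\<i> * of_real w) - exp (- (\<i> * of_real w))) / (2 * \<i>)"
      by (simp only: sin_of_real[symmetric] sin_exp_eq)
    then show ?thesis
      by (simp add: diff_divide_distrib right_diff_distrib)
  qed
  have neg: "- (u * fst p + v * snd p) = (- u) * fst p + (- v) * snd p" for p
    by simp
  show ?thesis
    unfolding sin neg by (intro trig_poly.add trig_poly.cmult trig_poly.character)
qed

lemma trig_poly_real_polynomial_sin:
  fixes P :: "real \<times> real \<Rightarrow> real"
  assumes "real_polynomial_function P"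
  shows "trig_poly (\<lambda>p. of_real (P (sin (a * fst p), sin (a * snd p))))"
  using assms
proof (induction rule: real_polynomial_function.induct)
  case (linear f)
  interpret bounded_linear f by fact
  have lin: "f (x, y) = f (1, 0) * x + f (0, 1) * y" for x y
  proof -
    have "f (x, y) = f (x *\<^sub>R (1, 0) + y *\<^sub>R (0, 1))"
      by simp
    also have "\<dots> = x *\<^sub>R f (1, 0) + y *\<^sub>R f (0, 1)"
      by (simp only: add scaleR)
    finally show ?thesis
      by (simp add: mult.commute)
  qed
  have *: "complex_of_real (f (sin (a * fst p), sin (a * snd p))) =
      of_real (f (1, 0)) * of_real (sin (a * fst p + 0 * snd p)) +
      of_real (f (0, 1)) * of_real (sin (0 * fst p + a * snd p))" for p
    by (subst lin) simp
  show ?case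
    unfolding * by (intro trig_poly.add trig_poly.cmult trig_poly_sin)
next
  case (const c)
  then show ?case by (rule trig_poly_const)
next
  case (add f g)
  then show ?case
    using trig_poly.add[OF add.IH] by simp
next
  case (mult f g)
  then show ?case
    using trig_poly_mult[OF mult.IH] by simp
qed

lemma borel_measurable_fst_snd [measurable]:
  "(fst :: real \<times> real \<Rightarrow> real) \<in> borel_measurable borel"
  "(snd :: real \<times> real \<Rightarrow> real) \<in> borel_measurable borel"
  by (intro borel_measurable_continuous_onI continuous_intros)+

lemma trig_poly_integrable:
  assumes "prob_space \<nu>" "sets \<nu> = sets borel" "trig_poly f"
  shows "integrable \<nu> f"
  using assms(3)
proof (induction rule: trig_poly.induct)
  case (character u v)
  interpret prob_space \<nu> by fact
  have [measurable_cong]: "sets \<nu> = sets borel" by fact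
  show ?case
    by (rule integrable_const_bound[where B = 1]) auto
qed auto

lemma trig_poly_integral_tendsto:
  assumes \<nu>: "\<And>i. prob_space (\<nu> i)" "\<And>i. sets (\<nu> i) = sets borel"
    and \<nu>': "prob_space \<nu>'" "sets \<nu>' = sets borel"
    and char: "\<And>u v. ((\<lambda>i. \<integral>p. iexp (u * fst p + v * snd p) \<partial>\<nu> i) \<longlongrightarrow> (\<integral>p. iexp (u * fst p + v * snd p) \<partial>\<nu>')) F"
    and "trig_poly f"
  shows "((\<lambda>i. \<integral>p. f p \<partial>\<nu> i) \<longlongrightarrow> (\<integral>p. f p \<partial>\<nu>')) F"
  using \<open>trig_poly f\<close>
proof (induction rule: trig_poly.induct)
  case (character u v)
  show ?case by (rule char)
next
  case (cmult f c)
  then show ?case by (auto intro: tendsto_intros)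
next
  case (add f g)
  have "(\<integral>p. f p + g p \<partial>\<nu> i) = (\<integral>p. f p \<partial>\<nu> i) + (\<integral>p. g p \<partial>\<nu> i)" for i
    using add \<nu> by (intro Bochner_Integration.integral_add trig_poly_integrable)
  moreover have "(\<integral>p. f p + g p \<partial>\<nu>') = (\<integral>p. f p \<partial>\<nu>') + (\<integral>p. g p \<partial>\<nu>')"
    using add \<nu>' by (intro Bochner_Integration.integral_add trig_poly_integrable)
  ultimately show ?case
    using add.IH by (auto intro: tendsto_add)
qed

text \<open>This is the only form of tightness that is used: the marginals do not vary.\<close>

lemma exists_tail_le:
  assumes "real_distribution \<mu>" "\<eta> > 0"
  shows "\<exists>N>0. measure \<mu> {x. \<bar>x\<bar> > N} \<le> \<eta>"
proof -
  interpret real_distribution \<mu> by fact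
  have "(\<lambda>n. prob {x. \<bar>x\<bar> > real n}) \<longlonglongrightarrow> prob (\<Inter>n. {x. \<bar>x\<bar> > real n})"
    by (intro finite_Lim_measure_decseq) (auto simp: decseq_def)
  moreover have "(\<Inter>n. {x::real. \<bar>x\<bar> > real n}) = {}"
  proof (intro equals0I)
    fix x :: real assume *: "x \<in> (\<Inter>n. {x. \<bar>x\<bar> > real n})"
    obtain n where "\<bar>x\<bar> < real n"
      using reals_Archimedean2 by auto
    then show False
      using INT_D[OF *, of n] by simp
  qed
  ultimately have "eventually (\<lambda>n. prob {x. \<bar>x\<bar> > real n} < \<eta>) sequentially"
    using assms(2) by (intro order_tendstoD(2)[where y = 0]) auto
  then have "eventually (\<lambda>n. prob {x. \<bar>x\<bar> > real n} < \<eta> \<and> n > 0) sequentially"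
    using eventually_gt_at_top by (rule eventually_conj)
  then obtain n where "prob {x. \<bar>x\<bar> > real n} < \<eta>" "n > 0"
    by (auto simp: eventually_sequentially)
  then show ?thesis
    by (intro exI[of _ "real n"]) auto
qed

text \<open>A trigonometric polynomial must be controlled on the whole plane and not only on the square \<open>[-N, N]\<^sup>2\<close>. For this the
  coordinates \<open>sin (a x)\<close>, \<open>sin (a y)\<close> are used: they map the square homeomorphically onto \<open>[-1, 1]\<^sup>2\<close> and the whole plane
  into it. An ordinary polynomial that is uniformly close on \<open>[-1, 1]\<^sup>2\<close> to \<open>f\<close>, written in these coordinates,
  is therefore also globally bounded.\<close>

lemma trig_poly_approx:
  fixes f :: "real \<times> real \<Rightarrow> real"
  assumes f: "continuous_on UNIV f" "\<And>p. \<bar>f p\<bar> \<le> B" and N: "N > 0" and \<delta>: "\<delta> > 0"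
  obtains q where "trig_poly (\<lambda>p. of_real (q p))" "\<And>p. \<bar>q p\<bar> \<le> B + \<delta>"
    "\<And>x y. \<bar>x\<bar> \<le> N \<Longrightarrow> \<bar>y\<bar> \<le> N \<Longrightarrow> \<bar>f (x, y) - q (x, y)\<bar> \<le> \<delta>"
proof -
  (* The sine is injective on [- pi/2, pi/2], which is the image of [-N, N] under multiplication by a. *)
  define a where "a = pi / (2 * N)"
  have a: "a > 0" "a * N = pi / 2"
    using N by (simp_all add: a_def)
  define g where "g = (\<lambda>p. f (arcsin (fst p) / a, arcsin (snd p) / a))"
  define S :: "(real \<times> real) set" where "S = {-1..1} \<times> {-1..1}"
  have cont: "continuous_on S g"
    unfolding g_def
    by (rule continuous_on_compose2[OF f(1)]) (use a in \<open>auto intro!: continuous_intros simp: S_def\<close>)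
  have "compact S"
    by (auto simp: S_def intro: compact_Times)
  then obtain P where P: "polynomial_function P" "\<And>p. p \<in> S \<Longrightarrow> norm (g p - P p) < \<delta>"
    using Stone_Weierstrass_polynomial_function[OF _ cont \<delta>] by auto
  define q where "q = (\<lambda>p. P (sin (a * fst p), sin (a * snd p)))"
  have sin_S: "(sin x, sin y) \<in> S" for x y
    by (simp add: S_def)
  show ?thesis
  proof (rule that)
    show "trig_poly (\<lambda>p. of_real (q p))"
      unfolding q_def using P(1)
      by (intro trig_poly_real_polynomial_sin) (simp add: real_polynomial_function_eq)
    show "\<bar>q p\<bar> \<le> B + \<delta>" for p
    proof -
      have "\<bar>g (sin (a * fst p), sin (a * snd p))\<bar> \<le> B"
        unfolding g_def by (rule f(2))
      then show ?thesis
        using P(2)[OF sin_S[of "a * fst p" "a * snd p"]] by (simp add: q_def)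
    qed
    show "\<bar>f (x, y) - q (x, y)\<bar> \<le> \<delta>" if xy: "\<bar>x\<bar> \<le> N" "\<bar>y\<bar> \<le> N" for x y
    proof -
      have "arcsin (sin (a * z)) = a * z" if "\<bar>z\<bar> \<le> N" for z
      proof -
        have "\<bar>a * z\<bar> \<le> pi / 2"
          using mult_left_mono[OF that, of a] a by (simp add: abs_mult)
        then show ?thesis
          by (intro arcsin_sin) auto
      qed
      then have "g (sin (a * x), sin (a * y)) = f (x, y)"
        using xy a by (simp add: g_def)
      then show ?thesis
        using P(2)[OF sin_S[of "a * x" "a * y"]] by (simp add: q_def)
    qed
  qed
qed

text \<open>Replacing \<open>f\<close> by a trigonometric polynomial changes the integral by at most \<open>e / 4\<close>, simultaneously for all laws with
  marginals \<open>\<mu>\<close>; for the trigonometric polynomial the convergence is a linear combination of convergences of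
  characteristic functions.\<close>

lemma converges_weakly_if_char_tendsto:
  fixes \<nu> :: "'i \<Rightarrow> (real \<times> real) measure"
  assumes \<nu>: "\<And>i. prob_space (\<nu> i)" "\<And>i. sets (\<nu> i) = sets borel"
    and \<nu>': "prob_space \<nu>'" "sets \<nu>' = sets borel"
    and marg: "\<And>i. distr (\<nu> i) borel fst = \<mu>" "\<And>i. distr (\<nu> i) borel snd = \<mu>"
    and marg': "distr \<nu>' borel fst = \<mu>" "distr \<nu>' borel snd = \<mu>"
    and char: "\<And>u v. ((\<lambda>i. \<integral>p. iexp (u * fst p + v * snd p) \<partial>\<nu> i) \<longlongrightarrow> (\<integral>p. iexp (u * fst p + v * snd p) \<partial>\<nu>')) F"
  shows "converges_weakly \<nu> \<nu>' F"
  unfolding converges_weakly_def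
proof (intro allI impI)
  fix f :: "real \<times> real \<Rightarrow> real"
  assume "continuous_on UNIV f \<and> bounded (range f)"
  then have contf: "continuous_on UNIV f" and "bounded (range f)" by auto
  then obtain B where fB: "\<And>p. \<bar>f p\<bar> \<le> B"
    by (auto simp: bounded_iff)
  have B: "B \<ge> 0"
    using fB[of 0] by linarith
  have f_meas: "f \<in> borel_measurable borel"
    by (rule borel_measurable_continuous_onI[OF contf])
  have "real_distribution \<mu>"
  proof -
    interpret prob_space \<nu>' by fact
    have [measurable_cong]: "sets \<nu>' = sets borel" by fact
    show ?thesis
      unfolding marg'(1)[symmetric] by (rule real_distribution_distr) measurable
  qed
  show "((\<lambda>i. \<integral>x. f x \<partial>\<nu> i) \<longlongrightarrow> (\<integral>x. f x \<partial>\<nu>')) F"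
  proof (rule tendstoI)
    fix e :: real assume e: "e > 0"
    define \<delta> where "\<delta> = min 1 (e / 8)"
    (* On the complement of the square the error is at most 2 B + 1, with probability at most 2 \<eta>. *)
    define \<eta> where "\<eta> = e / (16 * (2 * B + 1))"
    have \<delta>: "0 < \<delta>" "\<delta> \<le> 1" "\<delta> \<le> e / 8" and \<eta>: "\<eta> > 0" "(2 * B + 1) * (2 * \<eta>) = e / 8"
      using e B by (auto simp: \<delta>_def \<eta>_def field_simps)
    obtain N where N: "N > 0" "measure \<mu> {x. \<bar>x\<bar> > N} \<le> \<eta>"
      using exists_tail_le[OF \<open>real_distribution \<mu>\<close> \<eta>(1)] by auto
    obtain q where q: "trig_poly (\<lambda>p. of_real (q p))" "\<And>p. \<bar>q p\<bar> \<le> B + \<delta>"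
      "\<And>x y. \<bar>x\<bar> \<le> N \<Longrightarrow> \<bar>y\<bar> \<le> N \<Longrightarrow> \<bar>f (x, y) - q (x, y)\<bar> \<le> \<delta>"
      by (rule trig_poly_approx[OF contf fB N(1) \<delta>(1)]) (rule that)
    have approx: "\<bar>(\<integral>p. f p \<partial>\<zeta>) - (\<integral>p. q p \<partial>\<zeta>)\<bar> \<le> e / 4"
      if \<zeta>: "prob_space \<zeta>" "sets \<zeta> = sets borel" "distr \<zeta> borel fst = \<mu>" "distr \<zeta> borel snd = \<mu>"
      for \<zeta>
    proof -
      interpret prob_space \<zeta> by fact
      have [measurable_cong]: "sets \<zeta> = sets borel" by fact
      have "integrable \<zeta> (\<lambda>p. complex_of_real (q p))"
        by (rule trig_poly_integrable[OF \<zeta>(1,2) q(1)])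
      then have q_int: "integrable \<zeta> q"
        by (simp only: complex_of_real_integrable_eq)
      have f_int: "integrable \<zeta> f"
        using fB f_meas by (intro integrable_const_bound[where B = B]) auto
      define A1 where "A1 = {p :: real \<times> real. \<bar>fst p\<bar> > N}"
      define A2 where "A2 = {p :: real \<times> real. \<bar>snd p\<bar> > N}"
      have A_sets: "A1 \<in> sets \<zeta>" "A2 \<in> sets \<zeta>"
        unfolding A1_def A2_def \<zeta>(2) by measurable
      have m: "measure \<zeta> A1 \<le> \<eta>" "measure \<zeta> A2 \<le> \<eta>"
      proof -
        have "measure \<mu> {x. \<bar>x\<bar> > N} = measure \<zeta> (fst -` {x. \<bar>x\<bar> > N} \<inter> space \<zeta>)"
          unfolding \<zeta>(3)[symmetric] by (rule measure_distr) measurable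
        moreover have "measure \<mu> {x. \<bar>x\<bar> > N} = measure \<zeta> (snd -` {x. \<bar>x\<bar> > N} \<inter> space \<zeta>)"
          unfolding \<zeta>(4)[symmetric] by (rule measure_distr) measurable
        ultimately show "measure \<zeta> A1 \<le> \<eta>" "measure \<zeta> A2 \<le> \<eta>"
          using N(2) sets_eq_imp_space_eq[OF \<zeta>(2)] by (simp_all add: A1_def A2_def vimage_def)
      qed
      have i12: "integrable \<zeta> (indicat_real A1)" "integrable \<zeta> (indicat_real A2)"
        by (intro integrable_real_indicator A_sets; simp add: emeasure_eq_measure)+
      have pw: "\<bar>f p - q p\<bar> \<le> \<delta> + (2 * B + 1) * (indicator A1 p + indicator A2 p)" for p
      proof (cases "p \<in> A1 \<or> p \<in> A2")
        case True
        then have "(1::real) \<le> indicator A1 p + indicator A2 p"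
          by (auto simp: indicator_def)
        then have "2 * B + 1 \<le> (2 * B + 1) * (indicator A1 p + indicator A2 p)"
          using B mult_left_mono[of 1 "indicator A1 p + indicator A2 p" "2 * B + 1"] by simp
        then show ?thesis
          using fB[of p] q(2)[of p] \<delta> by linarith
      next
        case False
        then have "\<bar>f p - q p\<bar> \<le> \<delta>"
          using q(3)[of "fst p" "snd p"] by (simp add: A1_def A2_def)
        then show ?thesis
          using False by simp
      qed
      have "\<bar>(\<integral>p. f p \<partial>\<zeta>) - (\<integral>p. q p \<partial>\<zeta>)\<bar> = \<bar>\<integral>p. f p - q p \<partial>\<zeta>\<bar>"
        using f_int q_int by simp
      also have "\<dots> \<le> (\<integral>p. \<bar>f p - q p\<bar> \<partial>\<zeta>)"
        by (rule integral_abs_bound)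
      also have "\<dots> \<le> (\<integral>p. \<delta> + (2 * B + 1) * (indicator A1 p + indicator A2 p) \<partial>\<zeta>)"
        using f_int q_int i12 pw by (intro integral_mono integrable_norm Bochner_Integration.integrable_add
          Bochner_Integration.integrable_diff integrable_const integrable_mult_right integrable_abs) auto
      also have "\<dots> = \<delta> + (2 * B + 1) * (measure \<zeta> A1 + measure \<zeta> A2)"
      proof -
        have "(\<integral>p. indicator A1 p + indicator A2 p \<partial>\<zeta>) = measure \<zeta> A1 + measure \<zeta> A2"
          using i12 by (simp add: sets.Int_space_eq2 A_sets)
        then show ?thesis
          using i12 by (subst Bochner_Integration.integral_add)
            (auto simp: prob_space simp del: Bochner_Integration.integral_add)
      qed
      also have "\<dots> \<le> \<delta> + (2 * B + 1) * (2 * \<eta>)"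
        using m B by (intro add_left_mono mult_left_mono) auto
      also have "\<dots> \<le> e / 4"
        using \<delta> \<eta> by simp
      finally show ?thesis .
    qed
    have "((\<lambda>i. \<integral>p. complex_of_real (q p) \<partial>\<nu> i) \<longlongrightarrow> (\<integral>p. complex_of_real (q p) \<partial>\<nu>')) F"
      by (rule trig_poly_integral_tendsto[OF \<nu> \<nu>' char q(1)])
    then have "((\<lambda>i. \<integral>p. q p \<partial>\<nu> i) \<longlongrightarrow> (\<integral>p. q p \<partial>\<nu>')) F"
      by (simp only: integral_complex_of_real tendsto_of_real_iff)
    then have "eventually (\<lambda>i. dist (\<integral>p. q p \<partial>\<nu> i) (\<integral>p. q p \<partial>\<nu>') < e / 4) F"
      using e by (intro tendstoD) auto
    then show "eventually (\<lambda>i. dist (\<integral>p. f p \<partial>\<nu> i) (\<integral>p. f p \<partial>\<nu>') < e) F"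
    proof eventually_elim
      case (elim i)
      then show ?case
        using approx[OF \<nu>(1)[of i] \<nu>(2) marg] approx[OF \<nu>' marg'] e
        unfolding dist_real_def by linarith
    qed
  qed
qed


section \<open>Cyclic integrals\<close>

interpretation lborel_product: product_sigma_finite "\<lambda>i::nat. lborel :: real measure"
  by (rule product_sigma_finite.intro) (rule sigma_finite_lborel)

definition cyclic_integral :: "real \<Rightarrow> nat \<Rightarrow> (real \<Rightarrow> real) \<Rightarrow> real" where
  "cyclic_integral H k \<psi> =
     (\<integral>x. (\<Prod>i<k. \<psi> (x i)) * (\<Prod>i<k. \<bar>x i - x (Suc i mod k)\<bar> powr (H - 1))
        \<partial>(\<Pi>\<^sub>M i\<in>{..<k}. lborel))"

lemma cyclic_R_eq: "cyclic_R H k p \<theta> t = cyclic_integral H k (step_psi p \<theta> t)"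
  by (simp add: cyclic_R_def cyclic_integral_def)

lemma nn_integral_powr_unit_finite:
  fixes a :: real
  assumes a: "a > -1"
  shows "(\<integral>\<^sup>+z. ennreal (indicator {-1..1} z * \<bar>z\<bar> powr a) \<partial>lborel) < \<infinity>"
proof -
  define f where "f = (\<lambda>z::real. indicator {0..1} z * \<bar>z\<bar> powr a)"
  have f_meas [measurable]: "f \<in> borel_measurable borel"
    unfolding f_def by measurable
  have f0: "f z \<ge> 0" for z
    by (simp add: f_def)
  have "((\<lambda>z. z powr a) has_integral (1 powr (a + 1) / (a + 1))) {0..1}"
    by (rule has_integral_powr_from_0[OF a]) simp
  then have "((\<lambda>z. if z \<in> {0..1} then z powr a else 0) has_integral (1 / (a + 1))) UNIV"
    by (subst has_integral_restrict_UNIV) simp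
  also have "(\<lambda>z. if z \<in> {0..1} then z powr a else 0) = f"
    by (auto simp: f_def fun_eq_iff)
  finally have "(\<integral>\<^sup>+z. ennreal (f z) \<partial>lborel) = ennreal (1 / (a + 1))"
    by (rule nn_integral_has_integral_lborel[OF f_meas f0])
  then have fin: "(\<integral>\<^sup>+z. ennreal (f z) \<partial>lborel) < \<infinity>"
    by simp
  have "(\<integral>\<^sup>+z. ennreal (f z) \<partial>lborel) = (\<integral>\<^sup>+z. ennreal (f (- z)) \<partial>lborel)"
    using nn_integral_real_affine[of "\<lambda>z. ennreal (f z)" "-1" 0] by simp
  then have "(\<integral>\<^sup>+z. ennreal (f z) + ennreal (f (- z)) \<partial>lborel) < \<infinity>"
    using fin by (subst nn_integral_add) (auto simp: ennreal_add_eq_top less_top)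
  moreover have "(\<integral>\<^sup>+z. ennreal (indicator {-1..1} z * \<bar>z\<bar> powr a) \<partial>lborel) \<le>
      (\<integral>\<^sup>+z. ennreal (f z) + ennreal (f (- z)) \<partial>lborel)"
  proof (intro nn_integral_mono)
    fix z :: real
    have "indicator {-1..1} z * \<bar>z\<bar> powr a \<le> f z + f (- z)"
      by (auto simp: f_def indicator_def)
    then show "ennreal (indicator {-1..1} z * \<bar>z\<bar> powr a) \<le> ennreal (f z) + ennreal (f (- z))"
      using f0 by (simp add: ennreal_plus[symmetric] ennreal_leI del: ennreal_plus)
  qed
  ultimately show ?thesis
    by (rule le_less_trans[rotated])
qed

text \<open>Where \<open>\<bar>x - y\<bar> \<ge> 1\<close> the power is at most \<open>1\<close>, and the singularity contributes at most the integral over \<open>[-1, 1]\<close>,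
  whatever \<open>x\<close> is. The summand \<open>c\<close> covers the maximum of a power and a constant.\<close>

lemma nn_integral_kernel_bounded:
  fixes a s t c :: real
  assumes a: "a > -1" "a < 0" and c: "c \<ge> 0"
  shows "\<exists>C<\<infinity>. \<forall>x. (\<integral>\<^sup>+y. ennreal (indicator {s<..t} y * (\<bar>x - y\<bar> powr a + c)) \<partial>lborel) \<le> C"
proof -
  define g where "g = (\<lambda>z::real. indicator {-1..1} z * \<bar>z\<bar> powr a)"
  have [measurable]: "g \<in> borel_measurable borel"
    unfolding g_def by measurable
  have g0: "g z \<ge> 0" for z
    by (simp add: g_def)
  define C where "C = (\<integral>\<^sup>+y. ennreal ((1 + c) * indicator {s<..t} y) \<partial>lborel) + (\<integral>\<^sup>+z. ennreal (g z) \<partial>lborel)"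
  have "(\<integral>\<^sup>+y. ennreal ((1 + c) * indicator {s<..t} y) \<partial>lborel) =
      (\<integral>\<^sup>+y. ennreal (1 + c) * indicator {s<..t} y \<partial>lborel)"
    by (intro nn_integral_cong) (simp add: indicator_def)
  also have "\<dots> = ennreal (1 + c) * emeasure lborel {s<..t}"
    by (rule nn_integral_cmult_indicator) simp
  also have "\<dots> < \<infinity>"
    by (cases "s \<le> t") (auto simp: ennreal_mult_less_top)
  finally have "C < \<infinity>"
    using nn_integral_powr_unit_finite[OF a(1)] by (simp add: C_def g_def less_top)
  moreover have "(\<integral>\<^sup>+y. ennreal (indicator {s<..t} y * (\<bar>x - y\<bar> powr a + c)) \<partial>lborel) \<le> C" for x
  proof -
    have "indicator {s<..t} y * (\<bar>x - y\<bar> powr a + c) \<le> (1 + c) * indicator {s<..t} y + g (- x + 1 * y)" for y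
    proof (cases "\<bar>x - y\<bar> \<le> 1")
      case True
      then have "g (- x + 1 * y) = \<bar>x - y\<bar> powr a"
        by (auto simp: g_def indicator_def abs_minus_commute abs_le_iff)
      then show ?thesis
        using c by (simp add: indicator_def)
    next
      case False
      then have "\<bar>x - y\<bar> powr a \<le> \<bar>x - y\<bar> powr 0"
        using a by (intro powr_mono) auto
      then have "\<bar>x - y\<bar> powr a \<le> 1"
        using False by (simp split: if_splits)
      then show ?thesis
        using c g0[of "- x + 1 * y"] by (simp add: indicator_def)
    qed
    then have "(\<integral>\<^sup>+y. ennreal (indicator {s<..t} y * (\<bar>x - y\<bar> powr a + c)) \<partial>lborel) \<le>
      (\<integral>\<^sup>+y. ennreal ((1 + c) * indicator {s<..t} y) + ennreal (g (- x + 1 * y)) \<partial>lborel)"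
      using g0 c by (intro nn_integral_mono) (simp add: ennreal_plus[symmetric] ennreal_leI del: ennreal_plus)
    also have "\<dots> = (\<integral>\<^sup>+y. ennreal ((1 + c) * indicator {s<..t} y) \<partial>lborel) + (\<integral>\<^sup>+y. ennreal (g (- x + 1 * y)) \<partial>lborel)"
      by (intro nn_integral_add) measurable
    also have "(\<integral>\<^sup>+y. ennreal (g (- x + 1 * y)) \<partial>lborel) = (\<integral>\<^sup>+z. ennreal (g z) \<partial>lborel)"
      using nn_integral_real_affine[of "\<lambda>z. ennreal (g z)" 1 "- x"] by simp
    finally show ?thesis
      by (simp add: C_def)
  qed
  ultimately show ?thesis
    by auto
qed

lemma borel_measurable_component_PiM_lborel:
  "i < k \<Longrightarrow> (\<lambda>x. x i) \<in> borel_measurable (\<Pi>\<^sub>M i\<in>{..<k::nat}. lborel :: real measure)"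
  using measurable_component_singleton[of i "{..<k}" "\<lambda>i. lborel :: real measure"] by simp

text \<open>In an open chain each variable is linked to its predecessor only, so the variables can be integrated out one after the
  other, starting with the last.\<close>

lemma nn_integral_chain_le:
  fixes \<kappa> :: "real \<Rightarrow> real"
  assumes [measurable]: "\<kappa> \<in> borel_measurable borel" and \<kappa>0: "\<And>z. \<kappa> z \<ge> 0"
    and C: "\<And>x. (\<integral>\<^sup>+y. ennreal (indicator {s<..t} y * \<kappa> (x - y)) \<partial>lborel) \<le> C"
    and C': "(\<integral>\<^sup>+y. ennreal (indicator {s<..t} (y::real)) \<partial>lborel) \<le> C"
  shows "(\<integral>\<^sup>+x. ennreal (\<Prod>i<n. indicator {s<..t} (x i) * (if i = 0 then 1 else \<kappa> (x (i - 1) - x i)))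
      \<partial>(\<Pi>\<^sub>M i\<in>{..<n}. lborel)) \<le> C ^ n"
proof (induction n)
  case 0
  then show ?case
    by (simp add: PiM_empty)
next
  case (Suc n)
  define f where "f = (\<lambda>i (x :: nat \<Rightarrow> real). indicator {s<..t} (x i) * (if i = 0 then 1 else \<kappa> (x (i - 1) - x i)) :: real)"
  have f0: "f i x \<ge> 0" for i x
    by (simp add: f_def \<kappa>0)
  have meas: "f i \<in> borel_measurable (\<Pi>\<^sub>M i\<in>{..<m}. lborel)" if "i < m" for i m
  proof -
    have [measurable]: "(\<lambda>x. x i) \<in> borel_measurable (\<Pi>\<^sub>M i\<in>{..<m}. lborel)"
      "(\<lambda>x. x (i - 1)) \<in> borel_measurable (\<Pi>\<^sub>M i\<in>{..<m}. lborel)"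
      using that by (auto intro: borel_measurable_component_PiM_lborel)
    show ?thesis
      unfolding f_def by measurable
  qed
  have "(\<integral>\<^sup>+x. ennreal (\<Prod>i<Suc n. f i x) \<partial>(\<Pi>\<^sub>M i\<in>{..<Suc n}. lborel)) =
      (\<integral>\<^sup>+x. \<integral>\<^sup>+y. ennreal (\<Prod>i<Suc n. f i (x(n := y))) \<partial>lborel \<partial>(\<Pi>\<^sub>M i\<in>{..<n}. lborel))"
    unfolding lessThan_Suc
    by (rule lborel_product.product_nn_integral_insert)
      (use meas[of _ "Suc n"] in \<open>auto simp: lessThan_Suc intro!: measurable_compose[OF _ measurable_ennreal] borel_measurable_prod\<close>)
  also have "\<dots> \<le> (\<integral>\<^sup>+x. ennreal (\<Prod>i<n. f i x) * C \<partial>(\<Pi>\<^sub>M i\<in>{..<n}. lborel))"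
  proof (intro nn_integral_mono)
    fix x :: "nat \<Rightarrow> real"
    have "f i (x(n := y)) = f i x" if "i < n" for i y
      using that by (cases i) (auto simp: f_def)
    moreover have last: "f n (x(n := y)) = indicator {s<..t} y * (if n = 0 then 1 else \<kappa> (x (n - 1) - y))" for y
      by (cases n) (auto simp: f_def)
    ultimately have "(\<Prod>i<Suc n. f i (x(n := y))) =
        (\<Prod>i<n. f i x) * (indicator {s<..t} y * (if n = 0 then 1 else \<kappa> (x (n - 1) - y)))" for y
      by simp
    then have "(\<integral>\<^sup>+y. ennreal (\<Prod>i<Suc n. f i (x(n := y))) \<partial>lborel) =
        (\<integral>\<^sup>+y. ennreal (\<Prod>i<n. f i x) *
          ennreal (indicator {s<..t} y * (if n = 0 then 1 else \<kappa> (x (n - 1) - y))) \<partial>lborel)"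
      using f0 \<kappa>0 by (intro nn_integral_cong) (simp add: ennreal_mult prod_nonneg del: prod.lessThan_Suc)
    also have "\<dots> = ennreal (\<Prod>i<n. f i x) *
        (\<integral>\<^sup>+y. ennreal (indicator {s<..t} y * (if n = 0 then 1 else \<kappa> (x (n - 1) - y))) \<partial>lborel)"
      by (rule nn_integral_cmult) measurable
    also have "(\<integral>\<^sup>+y. ennreal (indicator {s<..t} y * (if n = 0 then 1 else \<kappa> (x (n - 1) - y))) \<partial>lborel) \<le> C"
      using C C' by (cases "n = 0") simp_all
    finally show "(\<integral>\<^sup>+y. ennreal (\<Prod>i<Suc n. f i (x(n := y))) \<partial>lborel) \<le> ennreal (\<Prod>i<n. f i x) * C"
      by (simp add: mult_left_mono)
  qed
  also have "\<dots> = (\<integral>\<^sup>+x. ennreal (\<Prod>i<n. f i x) \<partial>(\<Pi>\<^sub>M i\<in>{..<n}. lborel)) * C"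
    by (intro nn_integral_multc measurable_compose[OF _ measurable_ennreal] borel_measurable_prod meas) simp
  also have "\<dots> \<le> C ^ n * C"
    using Suc.IH by (intro mult_right_mono) (simp_all add: f_def)
  finally show ?case
    by (simp add: f_def mult.commute)
qed

lemma borel_measurable_cyclic_prod:
  assumes "\<And>i. i < k \<Longrightarrow> g i \<in> borel_measurable borel" "\<And>i. i < k \<Longrightarrow> \<kappa> i \<in> borel_measurable borel"
  shows "(\<lambda>x. (\<Prod>i<k. g i (x i)) * (\<Prod>i<k. \<kappa> i (x i - x (Suc i mod k))) :: real)
    \<in> borel_measurable (\<Pi>\<^sub>M i\<in>{..<k}. lborel :: real measure)"
proof -
  have "(\<lambda>x. g i (x i)) \<in> borel_measurable (\<Pi>\<^sub>M i\<in>{..<k}. lborel :: real measure)" if "i < k" for i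
    by (rule measurable_compose[OF borel_measurable_component_PiM_lborel[OF that] assms(1)[OF that]])
  moreover have "(\<lambda>x. \<kappa> i (x i - x (Suc i mod k))) \<in> borel_measurable (\<Pi>\<^sub>M i\<in>{..<k}. lborel :: real measure)"
    if "i < k" for i
  proof (rule measurable_compose[OF _ assms(2)[OF that]])
    show "(\<lambda>x. x i - x (Suc i mod k)) \<in> borel_measurable (\<Pi>\<^sub>M i\<in>{..<k}. lborel :: real measure)"
      using that by (intro borel_measurable_diff borel_measurable_component_PiM_lborel) auto
  qed
  ultimately show ?thesis
    by (intro borel_measurable_times borel_measurable_prod) auto
qed

text \<open>The last point of the cycle is linked to both of its neighbours. Estimating the product of these two factors by the sum
  of their squares allows this point to be integrated out, uniformly in the neighbours, and leaves an open chain. This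
  is where the square of the kernel has to be integrable; for \<open>\<bar>z\<bar> powr (H - 1)\<close> it means \<open>H > 1 / 2\<close>.\<close>

lemma cyclic_product_integrable:
  fixes \<kappa> :: "real \<Rightarrow> real"
  assumes \<kappa>_meas [measurable]: "\<kappa> \<in> borel_measurable borel" and \<kappa>0: "\<And>z. \<kappa> z \<ge> 0" and \<kappa>_sym: "\<And>z. \<kappa> (- z) = \<kappa> z"
    and C: "C < \<infinity>" "\<And>x. (\<integral>\<^sup>+y. ennreal (indicator {s<..t} y * \<kappa> (x - y)) \<partial>lborel) \<le> C"
    and D: "D < \<infinity>" "\<And>x. (\<integral>\<^sup>+y. ennreal (indicator {s<..t} y * (\<kappa> (x - y))\<^sup>2) \<partial>lborel) \<le> D"
    and k: "k \<ge> 2"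
  shows "integrable (\<Pi>\<^sub>M i\<in>{..<k}. lborel) (\<lambda>x. (\<Prod>i<k. indicator {s<..t} (x i)) * (\<Prod>i<k. \<kappa> (x i - x (Suc i mod k))))"
proof (rule integrableI_nonneg)
  let ?P = "\<lambda>k. \<Pi>\<^sub>M i\<in>{..<k::nat}. lborel :: real measure"
  let ?F = "\<lambda>x::nat \<Rightarrow> real. (\<Prod>i<k. indicator {s<..t} (x i)) * (\<Prod>i<k. \<kappa> (x i - x (Suc i mod k)))"
  show meas: "?F \<in> borel_measurable (?P k)"
    by (rule borel_measurable_cyclic_prod) simp_all
  show "AE x in ?P k. 0 \<le> ?F x"
    by (intro always_eventually allI mult_nonneg_nonneg prod_nonneg) (simp_all add: \<kappa>0)
  obtain n where n: "k = Suc (Suc n)"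
    using k by (metis Suc_le_D numeral_2_eq_2 Suc_le_mono)
  (* The last point has the index m, its predecessor n and its cyclic successor 0. *)
  define m where "m = Suc n"
  have km: "k = Suc m"
    by (simp add: n m_def)
  define f where "f = (\<lambda>i (x :: nat \<Rightarrow> real). indicator {s<..t} (x i) * (if i = 0 then 1 else \<kappa> (x (i - 1) - x i)) :: real)"
  have f0: "f i x \<ge> 0" for i x
    by (simp add: f_def \<kappa>0)
  have split: "?F (x(m := y)) = (\<Prod>i<m. f i x) * (indicator {s<..t} y * (\<kappa> (x n - y) * \<kappa> (y - x 0)))" for x y
  proof -
    have "(\<Prod>i<k. indicator {s<..t} ((x(m := y)) i)) = (\<Prod>i<m. indicator {s<..t} (x i)) * (indicator {s<..t} y :: real)"
      by (simp add: km)
    moreover have "(\<Prod>i<k. \<kappa> ((x(m := y)) i - (x(m := y)) (Suc i mod k))) =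
        (\<Prod>i<n. \<kappa> (x i - x (Suc i))) * \<kappa> (x n - y) * \<kappa> (y - x 0)"
      by (simp add: n m_def)
    moreover have "(\<Prod>i<m. f i x) = (\<Prod>i<m. indicator {s<..t} (x i)) * (\<Prod>i<n. \<kappa> (x i - x (Suc i)))"
    proof -
      have "(\<Prod>i<m. (if i = 0 then 1 else \<kappa> (x (i - 1) - x i))) = (\<Prod>i<n. \<kappa> (x i - x (Suc i)))"
        unfolding m_def by (subst prod.lessThan_Suc_shift) simp
      then show ?thesis
        by (simp only: f_def prod.distrib)
    qed
    ultimately show ?thesis
      by (simp add: mult_ac)
  qed
  have inner: "(\<integral>\<^sup>+y. ennreal (indicator {s<..t} y * (\<kappa> (u - y) * \<kappa> (y - v))) \<partial>lborel) \<le> D + D" for u v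
  proof -
    have "\<kappa> (u - y) * \<kappa> (y - v) \<le> (\<kappa> (u - y))\<^sup>2 + (\<kappa> (v - y))\<^sup>2" for y
    proof -
      have "\<kappa> (y - v) = \<kappa> (v - y)"
        using \<kappa>_sym[of "v - y"] by simp
      moreover have "2 * (\<kappa> (u - y) * \<kappa> (v - y)) \<le> (\<kappa> (u - y))\<^sup>2 + (\<kappa> (v - y))\<^sup>2"
        using sum_squares_bound[of "\<kappa> (u - y)" "\<kappa> (v - y)"] by (simp only: mult.assoc)
      moreover have "0 \<le> \<kappa> (u - y) * \<kappa> (v - y)"
        by (intro mult_nonneg_nonneg \<kappa>0)
      ultimately show ?thesis
        by simp
    qed
    then have "(\<integral>\<^sup>+y. ennreal (indicator {s<..t} y * (\<kappa> (u - y) * \<kappa> (y - v))) \<partial>lborel) \<le>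
        (\<integral>\<^sup>+y. ennreal (indicator {s<..t} y * (\<kappa> (u - y))\<^sup>2) + ennreal (indicator {s<..t} y * (\<kappa> (v - y))\<^sup>2) \<partial>lborel)"
      by (intro nn_integral_mono) (simp add: ennreal_plus[symmetric] ennreal_leI indicator_def del: ennreal_plus)
    also have "\<dots> = (\<integral>\<^sup>+y. ennreal (indicator {s<..t} y * (\<kappa> (u - y))\<^sup>2) \<partial>lborel) +
        (\<integral>\<^sup>+y. ennreal (indicator {s<..t} y * (\<kappa> (v - y))\<^sup>2) \<partial>lborel)"
      by (intro nn_integral_add) measurable
    also have "\<dots> \<le> D + D"
      by (intro add_mono D(2))
    finally show ?thesis .
  qed
  define E where "E = max C (\<integral>\<^sup>+y. ennreal (indicator {s<..t} (y::real)) \<partial>lborel)"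
  have "E < \<infinity>"
  proof -
    have "(\<integral>\<^sup>+y. ennreal (indicator {s<..t} (y::real)) \<partial>lborel) = emeasure lborel {s<..t}"
      by (simp add: ennreal_indicator)
    also have "\<dots> < \<infinity>"
      by (cases "s \<le> t") auto
    finally show ?thesis
      using C(1) by (simp add: E_def)
  qed
  have chain: "(\<integral>\<^sup>+x. ennreal (\<Prod>i<m. f i x) \<partial>?P m) \<le> E ^ m"
    unfolding f_def
    by (rule nn_integral_chain_le) (use C(2) \<kappa>0 in \<open>auto simp: E_def intro: le_max_iff_disj[THEN iffD2]\<close>)
  have prod_meas: "(\<lambda>x. ennreal (\<Prod>i<m. f i x)) \<in> borel_measurable (?P m)"
  proof (intro measurable_compose[OF _ measurable_ennreal] borel_measurable_prod)
    fix i assume "i \<in> {..<m}"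
    then have [measurable]: "(\<lambda>x. x i) \<in> borel_measurable (?P m)" "(\<lambda>x. x (i - 1)) \<in> borel_measurable (?P m)"
      by (auto intro: borel_measurable_component_PiM_lborel)
    show "f i \<in> borel_measurable (?P m)"
      unfolding f_def by measurable
  qed
  have "(\<integral>\<^sup>+x. ennreal (?F x) \<partial>?P k) = (\<integral>\<^sup>+x. \<integral>\<^sup>+y. ennreal (?F (x(m := y))) \<partial>lborel \<partial>?P m)"
    using meas unfolding km lessThan_Suc
    by (intro lborel_product.product_nn_integral_insert) auto
  also have "\<dots> \<le> (\<integral>\<^sup>+x. ennreal (\<Prod>i<m. f i x) * (D + D) \<partial>?P m)"
  proof (intro nn_integral_mono)
    fix x :: "nat \<Rightarrow> real"
    have "(\<integral>\<^sup>+y. ennreal (?F (x(m := y))) \<partial>lborel) =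
      (\<integral>\<^sup>+y. ennreal (\<Prod>i<m. f i x) * ennreal (indicator {s<..t} y * (\<kappa> (x n - y) * \<kappa> (y - x 0))) \<partial>lborel)"
      unfolding split using f0 \<kappa>0 by (simp add: ennreal_mult prod_nonneg)
    also have "\<dots> = ennreal (\<Prod>i<m. f i x) * (\<integral>\<^sup>+y. ennreal (indicator {s<..t} y * (\<kappa> (x n - y) * \<kappa> (y - x 0))) \<partial>lborel)"
      by (rule nn_integral_cmult) measurable
    also have "\<dots> \<le> ennreal (\<Prod>i<m. f i x) * (D + D)"
      by (intro mult_left_mono inner) simp
    finally show "(\<integral>\<^sup>+y. ennreal (?F (x(m := y))) \<partial>lborel) \<le> ennreal (\<Prod>i<m. f i x) * (D + D)" .
  qed
  also have "\<dots> = (\<integral>\<^sup>+x. ennreal (\<Prod>i<m. f i x) \<partial>?P m) * (D + D)"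
    by (rule nn_integral_multc[OF prod_meas])
  also have "\<dots> \<le> E ^ m * (D + D)"
    by (intro mult_right_mono chain) simp
  also have "\<dots> < \<infinity>"
    using \<open>E < \<infinity>\<close> D(1) by (simp add: ennreal_mult_less_top power_less_top_ennreal)
  finally show "(\<integral>\<^sup>+x. ennreal (?F x) \<partial>?P k) < \<infinity>" .
qed

lemma measurable_PiM_lborel_translate:
  "(\<lambda>x. \<lambda>i\<in>{..<k}. x i + c i) \<in>
    measurable (\<Pi>\<^sub>M i\<in>{..<k}. lborel) (\<Pi>\<^sub>M i\<in>{..<k::nat}. lborel :: real measure)"
proof (rule measurable_restrict)
  fix i assume "i \<in> {..<k}"
  then have "(\<lambda>x. x i) \<in> borel_measurable (\<Pi>\<^sub>M i\<in>{..<k}. lborel :: real measure)"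
    by (intro borel_measurable_component_PiM_lborel) simp
  then show "(\<lambda>x. x i + c i) \<in> measurable (\<Pi>\<^sub>M i\<in>{..<k}. lborel :: real measure) lborel"
    by simp
qed

lemma distr_PiM_lborel_translate:
  "distr (\<Pi>\<^sub>M i\<in>{..<k}. lborel) (\<Pi>\<^sub>M i\<in>{..<k}. lborel) (\<lambda>x. \<lambda>i\<in>{..<k}. x i + c i) =
    (\<Pi>\<^sub>M i\<in>{..<k::nat}. lborel :: real measure)"
proof (rule lborel_product.PiM_eqI[OF finite_lessThan])
  let ?P = "\<Pi>\<^sub>M i\<in>{..<k}. lborel :: real measure"
  let ?T = "\<lambda>x. \<lambda>i\<in>{..<k}. x i + c i"
  have T: "?T \<in> measurable ?P ?P"
    by (rule measurable_PiM_lborel_translate)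
  fix A :: "nat \<Rightarrow> real set" assume A: "\<And>i. i \<in> {..<k} \<Longrightarrow> A i \<in> sets lborel"
  define B where "B = (\<lambda>i. (\<lambda>y. y + c i) -` A i)"
  have B: "B i \<in> sets lborel" if "i \<in> {..<k}" for i
    using measurable_sets[of "\<lambda>y. y + c i" borel borel "A i"] A[OF that] by (simp add: B_def)
  have "emeasure (distr ?P ?P ?T) (Pi\<^sub>E {..<k} A) = emeasure ?P (?T -` Pi\<^sub>E {..<k} A \<inter> space ?P)"
    using A by (intro emeasure_distr[OF T] sets_PiM_I_finite) auto
  also have "?T -` Pi\<^sub>E {..<k} A \<inter> space ?P = Pi\<^sub>E {..<k} B"
    by (auto simp: space_PiM PiE_iff B_def extensional_def)
  also have "emeasure ?P (Pi\<^sub>E {..<k} B) = (\<Prod>i<k. emeasure lborel (B i))"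
    using B by (intro lborel_product.emeasure_PiM) auto
  also have "\<dots> = (\<Prod>i<k. emeasure lborel (A i))"
  proof (rule prod.cong[OF refl])
    fix i assume i: "i \<in> {..<k}"
    have "emeasure lborel (A i) = emeasure (distr lborel borel ((+) (c i))) (A i)"
      by (simp only: lborel_distr_plus)
    also have "\<dots> = emeasure lborel (B i)"
    proof -
      have "(\<lambda>y. y + c i) = (+) (c i)"
        by (simp add: fun_eq_iff)
      then show ?thesis
        using A[OF i] by (subst emeasure_distr) (simp_all add: B_def)
    qed
    finally show "emeasure lborel (B i) = emeasure lborel (A i)" ..
  qed
  finally show "emeasure (distr ?P ?P ?T) (Pi\<^sub>E {..<k} A) = (\<Prod>i<k. emeasure lborel (A i))" .
qed (simp_all)


lemma
  fixes f :: "(nat \<Rightarrow> real) \<Rightarrow> real"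
  assumes f: "f \<in> borel_measurable (\<Pi>\<^sub>M i\<in>{..<k}. lborel)"
    and cong: "\<And>x. f (\<lambda>i\<in>{..<k}. x i + c i) = g x"
  shows integrable_PiM_lborel_translate:
      "integrable (\<Pi>\<^sub>M i\<in>{..<k}. lborel) g \<longleftrightarrow> integrable (\<Pi>\<^sub>M i\<in>{..<k}. lborel) f"
    and integral_PiM_lborel_translate:
      "(\<integral>x. g x \<partial>(\<Pi>\<^sub>M i\<in>{..<k}. lborel)) = (\<integral>x. f x \<partial>(\<Pi>\<^sub>M i\<in>{..<k}. lborel))"
proof -
  let ?P = "\<Pi>\<^sub>M i\<in>{..<k}. lborel :: real measure"
  let ?T = "\<lambda>x. \<lambda>i\<in>{..<k}. x i + c i"
  have T: "?T \<in> measurable ?P ?P"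
    by (rule measurable_PiM_lborel_translate)
  show "integrable ?P g \<longleftrightarrow> integrable ?P f"
    using integrable_distr_eq[OF T f] unfolding distr_PiM_lborel_translate cong by simp
  show "(\<integral>x. g x \<partial>?P) = (\<integral>x. f x \<partial>?P)"
    using integral_distr[OF T f] unfolding distr_PiM_lborel_translate cong by simp
qed

lemma cyclic_integral_scale: "cyclic_integral H k (\<lambda>x. c * \<psi> x) = c ^ k * cyclic_integral H k \<psi>"
  by (simp add: cyclic_integral_def prod.distrib mult.assoc)

lemma cyclic_integral_translate:
  assumes [measurable]: "\<psi> \<in> borel_measurable borel"
  shows "cyclic_integral H k (\<lambda>x. \<psi> (x - \<tau>)) = cyclic_integral H k \<psi>"
  unfolding cyclic_integral_def
proof (rule integral_PiM_lborel_translate[where c = "\<lambda>_. - \<tau>"])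
  show "(\<lambda>x. (\<Prod>i<k. \<psi> (x i)) * (\<Prod>i<k. \<bar>x i - x (Suc i mod k)\<bar> powr (H - 1)))
      \<in> borel_measurable (\<Pi>\<^sub>M i\<in>{..<k}. lborel)"
    by (rule borel_measurable_cyclic_prod[where \<kappa> = "\<lambda>_ z. \<bar>z\<bar> powr (H - 1)"]) measurable
  show "(\<Prod>i<k. \<psi> ((\<lambda>i\<in>{..<k}. x i + - \<tau>) i)) *
      (\<Prod>i<k. \<bar>(\<lambda>i\<in>{..<k}. x i + - \<tau>) i - (\<lambda>i\<in>{..<k}. x i + - \<tau>) (Suc i mod k)\<bar> powr (H - 1)) =
    (\<Prod>i<k. \<psi> (x i - \<tau>)) * (\<Prod>i<k. \<bar>x i - x (Suc i mod k)\<bar> powr (H - 1))" for x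
  proof (intro arg_cong2[where f = "(*)"] prod.cong refl)
    fix i assume i: "i \<in> {..<k}"
    then have "Suc i mod k \<in> {..<k}" by simp
    then show "\<bar>(\<lambda>i\<in>{..<k}. x i + - \<tau>) i - (\<lambda>i\<in>{..<k}. x i + - \<tau>) (Suc i mod k)\<bar> powr (H - 1) =
        \<bar>x i - x (Suc i mod k)\<bar> powr (H - 1)"
      using i by (simp only: restrict_apply' add_diff_cancel_right)
    show "\<psi> ((\<lambda>i\<in>{..<k}. x i + - \<tau>) i) = \<psi> (x i - \<tau>)"
      using i by simp
  qed
qed

text \<open>If membership in \<open>A\<close> never changed along the cycle, it would be constant.\<close>

lemma exists_break:
  assumes "A \<subseteq> {..<k}" "A \<noteq> {}" "A \<noteq> {..<k::nat}"
  shows "\<exists>i<k. (i \<in> A) \<noteq> (Suc i mod k \<in> A)"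
proof (rule ccontr)
  assume "\<not> (\<exists>i<k. (i \<in> A) \<noteq> (Suc i mod k \<in> A))"
  then have *: "(i \<in> A) = (Suc i mod k \<in> A)" if "i < k" for i
    using that by blast
  have "i < k \<Longrightarrow> (i \<in> A) = (0 \<in> A)" for i
  proof (induction i)
    case (Suc i)
    then have "i < k" "Suc i mod k = Suc i"
      by simp_all
    then have "(i \<in> A) = (Suc i \<in> A)"
      using *[of i] by simp
    then show ?case
      using Suc.IH[OF \<open>i < k\<close>] by simp
  qed simp
  note * = this
  have "A = {} \<or> A = {..<k}"
  proof (cases "0 \<in> A")
    case True
    have "i \<in> A" if "i < k" for i
      using *[OF that] True by (simp only:)
    then show ?thesis
      using assms(1) by auto
  next
    case False
    have "i \<notin> A" if "i < k" for i
      using *[OF that] False by (simp only:) simp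
    then show ?thesis
      using assms(1) by auto
  qed
  then show False
    using assms by simp
qed

context
  fixes H s t :: real
  assumes H: "1 / 2 < H" "H < 1" and st: "s < t"
begin

text \<open>For two distinct points of \<open>(s, t]\<close> the kernel is at least \<open>(t - s) powr (H - 1)\<close>, but on the diagonal it is \<open>0 powr (H - 1) = 0\<close>. Taking the
  maximum makes this lower bound valid everywhere, so that the kernel between distant points is
  a small multiple of the majorant at nearby points, with no exceptional set.\<close>

definition kernel_majorant :: "real \<Rightarrow> real" where
  "kernel_majorant z = max (\<bar>z\<bar> powr (H - 1)) ((t - s) powr (H - 1))"

lemma kernel_majorant_nonneg: "kernel_majorant z \<ge> 0"
  by (simp add: kernel_majorant_def le_max_iff_disj)

lemma borel_measurable_kernel_majorant [measurable]: "kernel_majorant \<in> borel_measurable borel"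
  unfolding kernel_majorant_def[abs_def] by measurable

lemma kernel_majorant_integrable:
  assumes "k \<ge> 2"
  shows "integrable (\<Pi>\<^sub>M i\<in>{..<k}. lborel)
    (\<lambda>x. (\<Prod>i<k. indicator {s<..t} (x i)) * (\<Prod>i<k. kernel_majorant (x i - x (Suc i mod k))))"
proof -
  define b where "b = (t - s) powr (H - 1)"
  have b: "b \<ge> 0"
    by (simp add: b_def)
  obtain C where C: "C < \<infinity>" "\<And>x. (\<integral>\<^sup>+y. ennreal (indicator {s<..t} y * (\<bar>x - y\<bar> powr (H - 1) + b)) \<partial>lborel) \<le> C"
  proof -
    have "\<exists>C<\<infinity>. \<forall>x. (\<integral>\<^sup>+y. ennreal (indicator {s<..t} y * (\<bar>x - y\<bar> powr (H - 1) + b)) \<partial>lborel) \<le> C"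
      by (rule nn_integral_kernel_bounded) (use H b in simp_all)
    then show ?thesis
      by (elim exE conjE) (rule that, assumption, erule spec)
  qed
  obtain D where D: "D < \<infinity>" "\<And>x. (\<integral>\<^sup>+y. ennreal (indicator {s<..t} y * (\<bar>x - y\<bar> powr (2 * H - 2) + b\<^sup>2)) \<partial>lborel) \<le> D"
  proof -
    have "\<exists>D<\<infinity>. \<forall>x. (\<integral>\<^sup>+y. ennreal (indicator {s<..t} y * (\<bar>x - y\<bar> powr (2 * H - 2) + b\<^sup>2)) \<partial>lborel) \<le> D"
      by (rule nn_integral_kernel_bounded) (use H b in simp_all)
    then show ?thesis
      by (elim exE conjE) (rule that, assumption, erule spec)
  qed
  have le1: "kernel_majorant z \<le> \<bar>z\<bar> powr (H - 1) + b" for z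
    using b by (simp add: kernel_majorant_def b_def)
  have le2: "(kernel_majorant z)\<^sup>2 \<le> \<bar>z\<bar> powr (2 * H - 2) + b\<^sup>2" for z
  proof -
    have "\<bar>z\<bar> powr (2 * H - 2) = (\<bar>z\<bar> powr (H - 1))\<^sup>2"
    proof -
      have "(\<bar>z\<bar> powr (H - 1))\<^sup>2 = \<bar>z\<bar> powr ((H - 1) + (H - 1))"
        by (simp only: power2_eq_square powr_add)
      then show ?thesis
        by simp
    qed
    then show ?thesis
      unfolding kernel_majorant_def b_def[symmetric] max_def by simp
  qed
  show ?thesis
  proof (rule cyclic_product_integrable[OF borel_measurable_kernel_majorant kernel_majorant_nonneg _ C(1) _ D(1)])
    show "(\<integral>\<^sup>+y. ennreal (indicator {s<..t} y * kernel_majorant (x - y)) \<partial>lborel) \<le> C" for x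
      by (rule order_trans[OF nn_integral_mono C(2)[of x]]) (intro ennreal_leI mult_left_mono le1 indicator_pos_le)
    show "(\<integral>\<^sup>+y. ennreal (indicator {s<..t} y * (kernel_majorant (x - y))\<^sup>2) \<partial>lborel) \<le> D" for x
      by (rule order_trans[OF nn_integral_mono D(2)[of x]]) (intro ennreal_leI mult_left_mono le2 indicator_pos_le)
  qed (simp_all add: kernel_majorant_def assms)
qed

text \<open>All points are kept in \<open>(s, t]\<close>, and the \<open>i\<close>-th one enters the kernel after a translation by \<open>c i\<close>.\<close>

definition block_integrand :: "nat \<Rightarrow> (nat \<Rightarrow> real) \<Rightarrow> (nat \<Rightarrow> real) \<Rightarrow> real" where
  "block_integrand k c x = (\<Prod>i<k. indicator {s<..t} (x i)) *
     (\<Prod>i<k. \<bar>x i - x (Suc i mod k) + (c i - c (Suc i mod k))\<bar> powr (H - 1))"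

lemma borel_measurable_block_integrand:
  "block_integrand k c \<in> borel_measurable (\<Pi>\<^sub>M i\<in>{..<k}. lborel)"
  unfolding block_integrand_def[abs_def]
  by (rule borel_measurable_cyclic_prod[where \<kappa> = "\<lambda>i z. \<bar>z + (c i - c (Suc i mod k))\<bar> powr (H - 1)"]) simp_all

lemma powr_le_if_separated:
  assumes \<tau>: "\<tau> \<ge> 2 * (t - s)" and z: "\<bar>z\<bar> \<le> t - s" and d: "\<bar>d\<bar> = \<tau>"
  shows "\<bar>z + d\<bar> powr (H - 1) \<le> (\<tau> / (t - s) - 1) powr (H - 1) * kernel_majorant z"
proof -
  have "\<bar>z + d\<bar> \<ge> \<tau> - (t - s)"
    using z d by linarith
  then have "\<bar>z + d\<bar> powr (H - 1) \<le> (\<tau> - (t - s)) powr (H - 1)"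
    using \<tau> st H by (intro powr_mono2') auto
  also have "\<tau> - (t - s) = (\<tau> / (t - s) - 1) * (t - s)"
    using st by (simp add: field_simps)
  also have "\<dots> powr (H - 1) = (\<tau> / (t - s) - 1) powr (H - 1) * (t - s) powr (H - 1)"
    by (rule powr_mult)
  also have "\<dots> \<le> (\<tau> / (t - s) - 1) powr (H - 1) * kernel_majorant z"
    by (intro mult_left_mono) (simp_all add: kernel_majorant_def)
  finally show ?thesis .
qed

text \<open>A factor whose two points are translated by the same amount is dominated by the majorant itself. If the translations
  differ, the factor gains \<open>r = (\<tau> / (t - s) - 1) powr (H - 1)\<close>, which is at most \<open>1\<close> and vanishes as \<open>\<tau> \<rightarrow> \<infinity>\<close>.
  One such factor is enough.\<close>

lemma block_integrand_le:
  assumes \<tau>: "\<tau> \<ge> 2 * (t - s)" and k: "k \<ge> 2"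
    and c: "\<And>i. c i = 0 \<or> c i = \<tau>"
  shows "block_integrand k c x \<le>
    (\<Prod>i<k. indicator {s<..t} (x i)) * (\<Prod>i<k. kernel_majorant (x i - x (Suc i mod k)))"
    and "j < k \<Longrightarrow> c j \<noteq> c (Suc j mod k) \<Longrightarrow> block_integrand k c x \<le> (\<tau> / (t - s) - 1) powr (H - 1) *
    ((\<Prod>i<k. indicator {s<..t} (x i)) * (\<Prod>i<k. kernel_majorant (x i - x (Suc i mod k))))"
proof -
  define r where "r = (\<tau> / (t - s) - 1) powr (H - 1)"
  have "\<tau> / (t - s) - 1 \<ge> 1"
    using \<tau> st by (simp add: field_simps)
  then have "r \<le> (\<tau> / (t - s) - 1) powr 0"
    unfolding r_def using H by (intro powr_mono) auto
  then have r: "0 \<le> r" "r \<le> 1"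
    using \<open>\<tau> / (t - s) - 1 \<ge> 1\<close> by (auto simp: r_def split: if_splits)
  define w where "w = (\<lambda>i. if c i = c (Suc i mod k) then 1 else r)"
  have w: "0 \<le> w i" "w i \<le> 1" for i
    using r by (auto simp: w_def)
  have *: "block_integrand k c x \<le> (\<Prod>i<k. w i) *
    ((\<Prod>i<k. indicator {s<..t} (x i)) * (\<Prod>i<k. kernel_majorant (x i - x (Suc i mod k))))"
  proof (cases "\<forall>i<k. x i \<in> {s<..t}")
    case True
    have "(\<Prod>i<k. \<bar>x i - x (Suc i mod k) + (c i - c (Suc i mod k))\<bar> powr (H - 1)) \<le>
        (\<Prod>i<k. w i * kernel_majorant (x i - x (Suc i mod k)))"
    proof (intro prod_mono conjI)
      fix i assume i: "i \<in> {..<k}"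
      show "\<bar>x i - x (Suc i mod k) + (c i - c (Suc i mod k))\<bar> powr (H - 1) \<le>
        w i * kernel_majorant (x i - x (Suc i mod k))"
      proof (cases "c i = c (Suc i mod k)")
        case True
        then show ?thesis
          by (simp add: w_def kernel_majorant_def)
      next
        case False
        have "x i \<in> {s<..t}" "x (Suc i mod k) \<in> {s<..t}"
          using True i k by auto
        then have "\<bar>x i - x (Suc i mod k)\<bar> \<le> t - s"
          by auto
        moreover have "\<bar>c i - c (Suc i mod k)\<bar> = \<tau>"
          using c[of i] c[of "Suc i mod k"] False \<tau> st by auto
        ultimately show ?thesis
          using powr_le_if_separated[OF \<tau>] False by (simp add: w_def r_def)
      qed
    qed simp
    then show ?thesis
      using True by (simp add: block_integrand_def prod.distrib)
  next
    case False
    then obtain i where "i < k" "indicator {s<..t} (x i) = (0::real)"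
      by (auto simp: indicator_def)
    then have "(\<Prod>i<k. indicator {s<..t} (x i)) = (0::real)"
      by (intro prod_zero) auto
    then show ?thesis
      unfolding block_integrand_def by (simp only: mult_zero_left mult_zero_right order_refl)
  qed
  have G: "0 \<le> (\<Prod>i<k. indicator {s<..t} (x i)) * (\<Prod>i<k. kernel_majorant (x i - x (Suc i mod k)))"
    by (intro mult_nonneg_nonneg prod_nonneg) (auto simp: kernel_majorant_nonneg)
  have "(\<Prod>i<k. w i) \<le> 1"
    using w by (intro prod_le_1) auto
  then show "block_integrand k c x \<le>
    (\<Prod>i<k. indicator {s<..t} (x i)) * (\<Prod>i<k. kernel_majorant (x i - x (Suc i mod k)))"
    using mult_right_mono[OF _ G, of "\<Prod>i<k. w i" 1] * by simp
  assume j: "j < k" "c j \<noteq> c (Suc j mod k)"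
  have "(\<Prod>i<k. w i) = w j * (\<Prod>i\<in>{..<k} - {j}. w i)"
    using j by (intro prod.remove) auto
  also have "\<dots> \<le> w j * 1"
    using w by (intro mult_left_mono prod_le_1) auto
  finally have "(\<Prod>i<k. w i) \<le> r"
    using j by (simp add: w_def)
  from mult_right_mono[OF this G] * show "block_integrand k c x \<le> (\<tau> / (t - s) - 1) powr (H - 1) *
    ((\<Prod>i<k. indicator {s<..t} (x i)) * (\<Prod>i<k. kernel_majorant (x i - x (Suc i mod k))))"
    by (simp add: r_def)
qed

lemma block_integrand_nonneg: "block_integrand k c x \<ge> 0"
  unfolding block_integrand_def by (intro mult_nonneg_nonneg prod_nonneg) auto

lemma block_integrand_integrable:
  assumes "\<tau> \<ge> 2 * (t - s)" "k \<ge> 2" "\<And>i. c i = 0 \<or> c i = \<tau>"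
  shows "integrable (\<Pi>\<^sub>M i\<in>{..<k}. lborel) (block_integrand k c)"
proof (rule Bochner_Integration.integrable_bound[OF kernel_majorant_integrable borel_measurable_block_integrand])
  show "AE x in (\<Pi>\<^sub>M i\<in>{..<k}. lborel). norm (block_integrand k c x) \<le>
    norm ((\<Prod>i<k. indicator {s<..t} (x i)) * (\<Prod>i<k. kernel_majorant (x i - x (Suc i mod k))))"
  proof (intro always_eventually allI)
    fix x :: "nat \<Rightarrow> real"
    show "norm (block_integrand k c x) \<le>
      norm ((\<Prod>i<k. indicator {s<..t} (x i)) * (\<Prod>i<k. kernel_majorant (x i - x (Suc i mod k))))"
      using block_integrand_le(1)[where c = c and x = x, OF assms] block_integrand_nonneg[of k c x] by simp
  qed
qed (rule assms)

text \<open>The set \<open>A\<close> contains the indices of the points in \<open>(s, t]\<close>; the others lie in the translate by \<open>\<tau>\<close>.\<close>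

definition block_shift :: "nat set \<Rightarrow> real \<Rightarrow> nat \<Rightarrow> real" where
  "block_shift A \<tau> i = (if i \<in> A then 0 else \<tau>)"

lemma block_integral_tendsto_0:
  assumes k: "k \<ge> 2" and A: "A \<subseteq> {..<k}" "A \<noteq> {}" "A \<noteq> {..<k}"
  shows "((\<lambda>\<tau>. \<integral>x. block_integrand k (block_shift A \<tau>) x \<partial>(\<Pi>\<^sub>M i\<in>{..<k}. lborel)) \<longlongrightarrow> 0) at_top"
proof -
  let ?P = "\<Pi>\<^sub>M i\<in>{..<k}. lborel :: real measure"
  let ?G = "\<lambda>x::nat \<Rightarrow> real. (\<Prod>i<k. indicator {s<..t} (x i)) * (\<Prod>i<k. kernel_majorant (x i - x (Suc i mod k)))"
  obtain j where j: "j < k" "(j \<in> A) \<noteq> (Suc j mod k \<in> A)"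
    using exists_break[OF A] by auto
  have "eventually (\<lambda>\<tau>. \<tau> \<ge> 2 * (t - s)) at_top"
    by (rule eventually_ge_at_top)
  then have ev: "eventually (\<lambda>\<tau>. norm (\<integral>x. block_integrand k (block_shift A \<tau>) x \<partial>?P) \<le>
      (\<tau> / (t - s) - 1) powr (H - 1) * (\<integral>x. ?G x \<partial>?P)) at_top"
  proof eventually_elim
    case (elim \<tau>)
    have c: "block_shift A \<tau> i = 0 \<or> block_shift A \<tau> i = \<tau>" for i
      by (simp add: block_shift_def)
    have cj: "block_shift A \<tau> j \<noteq> block_shift A \<tau> (Suc j mod k)"
      using j elim st by (auto simp: block_shift_def)
    have "(\<integral>x. block_integrand k (block_shift A \<tau>) x \<partial>?P) \<le> (\<integral>x. (\<tau> / (t - s) - 1) powr (H - 1) * ?G x \<partial>?P)"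
      by (intro integral_mono block_integrand_integrable[OF elim k c] integrable_mult_right kernel_majorant_integrable[OF k]
          block_integrand_le(2)[OF elim k c j(1) cj])
    then show ?case
      using block_integrand_nonneg by (simp add: integral_nonneg)
  qed
  have "((\<lambda>\<tau>. (\<tau> / (t - s) - 1) powr (H - 1) * (\<integral>x. ?G x \<partial>?P)) \<longlongrightarrow> 0 * (\<integral>x. ?G x \<partial>?P)) at_top"
  proof (intro tendsto_mult tendsto_const tendsto_neg_powr)
    have "filterlim (\<lambda>\<tau>. (1 / (t - s)) * \<tau>) at_top at_top"
      using st by (intro filterlim_tendsto_pos_mult_at_top[OF tendsto_const _ filterlim_ident]) simp
    then have "filterlim (\<lambda>\<tau>. (- 1) + (1 / (t - s)) * \<tau>) at_top at_top"
      by (intro filterlim_tendsto_add_at_top[OF tendsto_const])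
    then show "filterlim (\<lambda>\<tau>. \<tau> / (t - s) - 1) at_top at_top"
      by simp
  qed (use H in simp)
  then have "((\<lambda>\<tau>. (\<tau> / (t - s) - 1) powr (H - 1) * (\<integral>x. ?G x \<partial>?P)) \<longlongrightarrow> 0) at_top"
    by simp
  with ev show ?thesis
    by (rule Lim_null_comparison)
qed

lemma block_integral_eq:
  assumes "A = {} \<or> A = {..<k}"
  shows "(\<integral>x. block_integrand k (block_shift A \<tau>) x \<partial>(\<Pi>\<^sub>M i\<in>{..<k}. lborel)) =
    cyclic_integral H k (indicator {s<..t})"
proof -
  have same: "block_shift A \<tau> i - block_shift A \<tau> (Suc i mod k) = 0" if "i < k" for i
  proof -
    have "Suc i mod k < k"
      using that by simp
    then show ?thesis
      using assms that by (auto simp: block_shift_def)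
  qed
  have "block_integrand k (block_shift A \<tau>) x =
     (\<Prod>i<k. indicator {s<..t} (x i)) * (\<Prod>i<k. \<bar>x i - x (Suc i mod k)\<bar> powr (H - 1))" for x
    unfolding block_integrand_def by (intro arg_cong2[where f = "(*)"] prod.cong refl) (simp add: same)
  then show ?thesis
    by (simp add: cyclic_integral_def)
qed

text \<open>The product \<open>\<Prod>i. \<psi> (x i)\<close> is multiplied out, and in the summand of \<open>A\<close> the points with indices outside \<open>A\<close> are
  moved back to \<open>(s, t]\<close> by a translation of the integration variables.\<close>

lemma cyclic_integral_expand:
  assumes \<tau>: "\<tau> \<ge> 2 * (t - s)" and k: "k \<ge> 2"
  shows "cyclic_integral H k (\<lambda>x. u * indicator {s<..t} x + v * indicator {s + \<tau><..t + \<tau>} x) =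
    (\<Sum>A\<in>Pow {..<k}. u ^ card A * v ^ card ({..<k} - A) *
      (\<integral>x. block_integrand k (block_shift A \<tau>) x \<partial>(\<Pi>\<^sub>M i\<in>{..<k}. lborel)))"
proof -
  let ?P = "\<Pi>\<^sub>M i\<in>{..<k}. lborel :: real measure"
  define W where "W = (\<lambda>x::nat \<Rightarrow> real. \<Prod>i<k. \<bar>x i - x (Suc i mod k)\<bar> powr (H - 1))"
  define g where "g = (\<lambda>A i y. indicator {s<..t} (y - block_shift A \<tau> i) :: real)"
  define f where "f = (\<lambda>A x. (\<Prod>i<k. g A i (x i)) * W x)"
  have f_meas: "f A \<in> borel_measurable ?P" for A
    unfolding f_def W_def
    by (rule borel_measurable_cyclic_prod[where \<kappa> = "\<lambda>_ z. \<bar>z\<bar> powr (H - 1)"]) (simp_all add: g_def)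
  have shift: "f A (\<lambda>i\<in>{..<k}. x i + block_shift A \<tau> i) = block_integrand k (block_shift A \<tau>) x" for A x
  proof -
    have "Suc i mod k < k" for i
      using k by simp
    then show ?thesis
      unfolding f_def W_def block_integrand_def g_def
      by (intro arg_cong2[where f = "(*)"] prod.cong) (auto simp: algebra_simps)
  qed
  have f_int: "integrable ?P (f A)" for A
    using integrable_PiM_lborel_translate[OF f_meas shift] block_integrand_integrable[OF \<tau> k]
    by (simp add: block_shift_def)
  have f_eq: "(\<integral>x. f A x \<partial>?P) = (\<integral>x. block_integrand k (block_shift A \<tau>) x \<partial>?P)" for A
    by (rule integral_PiM_lborel_translate[OF f_meas shift, symmetric])
  have "(\<Prod>i<k. u * indicator {s<..t} (x i) + v * indicator {s + \<tau><..t + \<tau>} (x i)) * W x =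
    (\<Sum>A\<in>Pow {..<k}. u ^ card A * v ^ card ({..<k} - A) * f A x)" for x
  proof -
    have "(\<Prod>i\<in>A. u * indicator {s<..t} (x i)) * (\<Prod>i\<in>{..<k} - A. v * indicator {s + \<tau><..t + \<tau>} (x i)) =
      u ^ card A * v ^ card ({..<k} - A) * (\<Prod>i<k. g A i (x i))" if A: "A \<in> Pow {..<k}" for A
    proof -
      have "(\<Prod>i<k. g A i (x i)) = (\<Prod>i\<in>{..<k} - A. g A i (x i)) * (\<Prod>i\<in>A. g A i (x i))"
        using A by (intro prod.subset_diff) auto
      also have "(\<Prod>i\<in>A. g A i (x i)) = (\<Prod>i\<in>A. indicator {s<..t} (x i))"
        by (intro prod.cong) (auto simp: g_def block_shift_def)
      also have "(\<Prod>i\<in>{..<k} - A. g A i (x i)) = (\<Prod>i\<in>{..<k} - A. indicator {s + \<tau><..t + \<tau>} (x i))"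
        by (intro prod.cong) (auto simp: g_def block_shift_def indicator_def)
      finally show ?thesis
        by (simp add: prod.distrib mult_ac)
    qed
    note eq = this
    have "(\<Prod>i<k. u * indicator {s<..t} (x i) + v * indicator {s + \<tau><..t + \<tau>} (x i)) * W x =
      (\<Sum>A\<in>Pow {..<k}. (\<Prod>i\<in>A. u * indicator {s<..t} (x i)) *
        (\<Prod>i\<in>{..<k} - A. v * indicator {s + \<tau><..t + \<tau>} (x i)) * W x)"
      by (simp only: prod_add[OF finite_lessThan] sum_distrib_right)
    also have "\<dots> = (\<Sum>A\<in>Pow {..<k}. u ^ card A * v ^ card ({..<k} - A) * f A x)"
      by (intro sum.cong refl) (simp only: eq f_def mult.assoc)
    finally show ?thesis .
  qed
  then have "cyclic_integral H k (\<lambda>x. u * indicator {s<..t} x + v * indicator {s + \<tau><..t + \<tau>} x) =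
    (\<integral>x. (\<Sum>A\<in>Pow {..<k}. u ^ card A * v ^ card ({..<k} - A) * f A x) \<partial>?P)"
    by (simp add: cyclic_integral_def W_def)
  also have "\<dots> = (\<Sum>A\<in>Pow {..<k}. u ^ card A * v ^ card ({..<k} - A) * (\<integral>x. f A x \<partial>?P))"
    using f_int by (subst Bochner_Integration.integral_sum) auto
  finally show ?thesis
    by (simp only: f_eq)
qed

text \<open>Only the two unmixed summands \<open>A = {}\<close> and \<open>A = {..<k}\<close> survive.\<close>

lemma cyclic_integral_tendsto:
  assumes k: "k \<ge> 2"
  shows "((\<lambda>\<tau>. cyclic_integral H k (\<lambda>x. u * indicator {s<..t} x + v * indicator {s + \<tau><..t + \<tau>} x))
    \<longlongrightarrow> (u ^ k + v ^ k) * cyclic_integral H k (indicator {s<..t})) at_top"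
proof -
  let ?T = "\<lambda>A \<tau>. \<integral>x. block_integrand k (block_shift A \<tau>) x \<partial>(\<Pi>\<^sub>M i\<in>{..<k}. lborel)"
  let ?I = "cyclic_integral H k (indicator {s<..t})"
  have "((\<lambda>\<tau>. ?T A \<tau>) \<longlongrightarrow> (if A = {} \<or> A = {..<k} then ?I else 0)) at_top" if "A \<in> Pow {..<k}" for A
    using block_integral_tendsto_0[OF k, of A] block_integral_eq[of A k] that by auto
  then have "((\<lambda>\<tau>. \<Sum>A\<in>Pow {..<k}. u ^ card A * v ^ card ({..<k} - A) * ?T A \<tau>) \<longlongrightarrow>
    (\<Sum>A\<in>Pow {..<k}. u ^ card A * v ^ card ({..<k} - A) * (if A = {} \<or> A = {..<k} then ?I else 0))) at_top"
    by (intro tendsto_sum tendsto_mult tendsto_const)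
  also have "(\<Sum>A\<in>Pow {..<k}. u ^ card A * v ^ card ({..<k} - A) * (if A = {} \<or> A = {..<k} then ?I else 0)) =
    (\<Sum>A\<in>{{}, {..<k}}. u ^ card A * v ^ card ({..<k} - A) * ?I)"
    by (intro sum.mono_neutral_cong_right) auto
  also have "\<dots> = (u ^ k + v ^ k) * ?I"
  proof -
    have "{} \<noteq> {..<k}"
      using k by (metis empty_iff lessThan_iff less_le_trans zero_less_numeral)
    then show ?thesis
      by (simp add: algebra_simps)
  qed
  finally have lim: "((\<lambda>\<tau>. \<Sum>A\<in>Pow {..<k}. u ^ card A * v ^ card ({..<k} - A) * ?T A \<tau>) \<longlongrightarrow> (u ^ k + v ^ k) * ?I) at_top" .
  have "eventually (\<lambda>\<tau>. \<tau> \<ge> 2 * (t - s)) at_top"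
    by (rule eventually_ge_at_top)
  then have "eventually (\<lambda>\<tau>. (\<Sum>A\<in>Pow {..<k}. u ^ card A * v ^ card ({..<k} - A) * ?T A \<tau>) =
    cyclic_integral H k (\<lambda>x. u * indicator {s<..t} x + v * indicator {s + \<tau><..t + \<tau>} x)) at_top"
    by eventually_elim (simp only: cyclic_integral_expand[OF _ k])
  with lim show ?thesis
    by (rule Lim_transform_eventually)
qed

end


section \<open>Asymptotic independence of the increments\<close>

lemma log_coeffs_product:
  assumes "log_coeffs f \<kappa>"
    and g: "\<And>x::real. g (of_real x) = f (of_real (u * x)) * f (of_real (v * x))"
  shows "log_coeffs g (\<lambda>k. \<kappa> k * of_real (u ^ k + v ^ k))"
proof -
  from assms(1)[unfolded log_coeffs_def] obtain \<epsilon> where \<epsilon>: "\<epsilon> > 0" and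
    *: "\<forall>x::real. \<bar>x\<bar> < \<epsilon> \<longrightarrow> summable (\<lambda>k. \<kappa> k * of_real x ^ k) \<and>
      f (of_real x) = exp (\<Sum>k. \<kappa> k * of_real x ^ k)"
    by (elim exE conjE)
  define \<epsilon>' where "\<epsilon>' = \<epsilon> / (1 + \<bar>u\<bar> + \<bar>v\<bar>)"
  have \<epsilon>': "\<epsilon>' > 0"
    using \<epsilon> by (simp add: \<epsilon>'_def add_pos_nonneg)
  have small: "\<bar>w * x\<bar> < \<epsilon>" if "\<bar>x\<bar> < \<epsilon>'" "\<bar>w\<bar> \<le> \<bar>u\<bar> + \<bar>v\<bar>" for w x
  proof -
    have "\<bar>w * x\<bar> = \<bar>x\<bar> * \<bar>w\<bar>"
      by (simp add: abs_mult)
    also have "\<dots> \<le> \<bar>x\<bar> * (1 + \<bar>u\<bar> + \<bar>v\<bar>)"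
      using that by (intro mult_left_mono) auto
    also have "\<dots> < \<epsilon>"
      using that(1) by (simp add: \<epsilon>'_def pos_less_divide_eq add_pos_nonneg)
    finally show ?thesis .
  qed
  show ?thesis
    unfolding log_coeffs_def
  proof (intro exI[of _ \<epsilon>'] conjI \<epsilon>' allI impI)
    fix x :: real assume x: "\<bar>x\<bar> < \<epsilon>'"
    have u: "summable (\<lambda>k. \<kappa> k * of_real (u * x) ^ k)" "f (of_real (u * x)) = exp (\<Sum>k. \<kappa> k * of_real (u * x) ^ k)"
      using *[rule_format, OF small[OF x, of u]] by simp_all
    have v: "summable (\<lambda>k. \<kappa> k * of_real (v * x) ^ k)" "f (of_real (v * x)) = exp (\<Sum>k. \<kappa> k * of_real (v * x) ^ k)"
      using *[rule_format, OF small[OF x, of v]] by simp_all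
    have eq: "(\<lambda>k. \<kappa> k * of_real (u ^ k + v ^ k) * of_real x ^ k) =
        (\<lambda>k. \<kappa> k * of_real (u * x) ^ k + \<kappa> k * of_real (v * x) ^ k)"
      by (simp add: fun_eq_iff power_mult_distrib algebra_simps)
    show "summable (\<lambda>k. \<kappa> k * of_real (u ^ k + v ^ k) * of_real x ^ k)"
      unfolding eq by (intro summable_add u v)
    show "g (of_real x) = exp (\<Sum>k. \<kappa> k * of_real (u ^ k + v ^ k) * of_real x ^ k)"
      unfolding eq suminf_add[OF u(1) v(1), symmetric] g u(2) v(2) by (rule exp_add[symmetric])
  qed
qed

definition linear_law :: "real \<Rightarrow> real \<Rightarrow> (real \<times> real) measure \<Rightarrow> real measure" where
  "linear_law u v \<nu> = distr \<nu> borel (\<lambda>p. u * fst p + v * snd p)"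

lemma distr_pair_snd_prob:
  assumes "prob_space M" "prob_space N"
  shows "distr (M \<Otimes>\<^sub>M N) N snd = N"
proof (rule measure_eqI)
  interpret M: prob_space M by fact
  interpret N: prob_space N by fact
  fix A assume A: "A \<in> sets (distr (M \<Otimes>\<^sub>M N) N snd)"
  then have "emeasure (distr (M \<Otimes>\<^sub>M N) N snd) A = emeasure (M \<Otimes>\<^sub>M N) (space M \<times> A)"
    by (auto simp: emeasure_distr space_pair_measure dest: sets.sets_into_space intro!: arg_cong2[where f = emeasure])
  also have "\<dots> = emeasure N A"
    using A by (simp add: N.emeasure_pair_measure_Times M.emeasure_space_1)
  finally show "emeasure (distr (M \<Otimes>\<^sub>M N) N snd) A = emeasure N A" .
qed simp

context
  fixes \<nu> :: "(real \<times> real) measure"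
  assumes \<nu>: "prob_space \<nu>" "sets \<nu> = sets borel"
begin

interpretation prob_space \<nu> by (rule \<nu>)

lemma real_distribution_linear_law: "real_distribution (linear_law u v \<nu>)"
proof -
  have [measurable_cong]: "sets \<nu> = sets borel" by (rule \<nu>)
  show ?thesis
    unfolding linear_law_def by (rule real_distribution_distr) measurable
qed

lemma char_linear_law:
  "char (linear_law u v \<nu>) x = (\<integral>p. iexp ((x * u) * fst p + (x * v) * snd p) \<partial>\<nu>)"
proof -
  have [measurable_cong]: "sets \<nu> = sets borel" by (rule \<nu>)
  have "char (linear_law u v \<nu>) x = (\<integral>p. iexp (x * (u * fst p + v * snd p)) \<partial>\<nu>)"
    unfolding char_def linear_law_def by (subst integral_distr) measurable
  then show ?thesis
    by (simp add: algebra_simps)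
qed

text \<open>The bound depends on the marginals only, and not on the dependence between the two coordinates.\<close>

lemma linear_law_exponential_moment:
  assumes marg: "distr \<nu> borel fst = \<mu>" "distr \<nu> borel snd = \<mu>"
    and int: "integrable \<mu> (\<lambda>x. exp (c * \<bar>x\<bar>))"
    and c': "c' \<ge> 0" "2 * c' * (1 + \<bar>u\<bar> + \<bar>v\<bar>) \<le> c"
  shows "integrable (linear_law u v \<nu>) (\<lambda>x. exp (c' * \<bar>x\<bar>))"
    and "(\<integral>x. exp (c' * \<bar>x\<bar>) \<partial>linear_law u v \<nu>) \<le> 2 * (\<integral>x. exp (c * \<bar>x\<bar>) \<partial>\<mu>)"
proof -
  have [measurable_cong]: "sets \<nu> = sets borel" by (rule \<nu>)
  have int1: "integrable \<nu> (\<lambda>p. exp (c * \<bar>fst p\<bar>))"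
    using int unfolding marg(1)[symmetric] by (subst (asm) integrable_distr_eq) auto
  have eq1: "(\<integral>p. exp (c * \<bar>fst p\<bar>) \<partial>\<nu>) = (\<integral>x. exp (c * \<bar>x\<bar>) \<partial>\<mu>)"
    unfolding marg(1)[symmetric] by (subst integral_distr) auto
  have int2: "integrable \<nu> (\<lambda>p. exp (c * \<bar>snd p\<bar>))"
    using int unfolding marg(2)[symmetric] by (subst (asm) integrable_distr_eq) auto
  have eq2: "(\<integral>p. exp (c * \<bar>snd p\<bar>) \<partial>\<nu>) = (\<integral>x. exp (c * \<bar>x\<bar>) \<partial>\<mu>)"
    unfolding marg(2)[symmetric] by (subst integral_distr) auto
  have le: "exp (c' * \<bar>u * x + v * y\<bar>) \<le> exp (c * \<bar>x\<bar>) + exp (c * \<bar>y\<bar>)" for x y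
  proof -
    define z where "z = max \<bar>x\<bar> \<bar>y\<bar>"
    have z: "z \<ge> 0" "\<bar>x\<bar> \<le> z" "\<bar>y\<bar> \<le> z"
      by (auto simp: z_def)
    have "\<bar>u * x + v * y\<bar> \<le> \<bar>u\<bar> * \<bar>x\<bar> + \<bar>v\<bar> * \<bar>y\<bar>"
      by (metis abs_mult abs_triangle_ineq)
    also have "\<dots> \<le> \<bar>u\<bar> * z + \<bar>v\<bar> * z"
      using z by (intro add_mono mult_left_mono) auto
    also have "\<dots> \<le> 2 * (1 + \<bar>u\<bar> + \<bar>v\<bar>) * z"
      using z by (simp add: algebra_simps)
    finally have "c' * \<bar>u * x + v * y\<bar> \<le> c' * (2 * (1 + \<bar>u\<bar> + \<bar>v\<bar>) * z)"
      using c'(1) by (rule mult_left_mono)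
    also have "\<dots> = (2 * c' * (1 + \<bar>u\<bar> + \<bar>v\<bar>)) * z"
      by simp
    also have "\<dots> \<le> c * z"
      using c'(2) z by (intro mult_right_mono) auto
    finally have "exp (c' * \<bar>u * x + v * y\<bar>) \<le> exp (c * z)"
      by simp
    also have "exp (c * z) \<le> exp (c * \<bar>x\<bar>) + exp (c * \<bar>y\<bar>)"
      by (simp add: z_def max_def)
    finally show ?thesis .
  qed
  have int3: "integrable \<nu> (\<lambda>p. exp (c' * \<bar>u * fst p + v * snd p\<bar>))"
  proof (rule Bochner_Integration.integrable_bound[OF Bochner_Integration.integrable_add[OF int1 int2]])
    show "AE p in \<nu>. norm (exp (c' * \<bar>u * fst p + v * snd p\<bar>)) \<le> norm (exp (c * \<bar>fst p\<bar>) + exp (c * \<bar>snd p\<bar>))"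
      using le by (intro always_eventually allI) (auto intro: order_trans[OF le])
  qed measurable
  then show "integrable (linear_law u v \<nu>) (\<lambda>x. exp (c' * \<bar>x\<bar>))"
    unfolding linear_law_def by (subst integrable_distr_eq) auto
  have "(\<integral>x. exp (c' * \<bar>x\<bar>) \<partial>linear_law u v \<nu>) = (\<integral>p. exp (c' * \<bar>u * fst p + v * snd p\<bar>) \<partial>\<nu>)"
    unfolding linear_law_def by (subst integral_distr) auto
  also have "\<dots> \<le> (\<integral>p. exp (c * \<bar>fst p\<bar>) + exp (c * \<bar>snd p\<bar>) \<partial>\<nu>)"
    by (intro integral_mono int3 Bochner_Integration.integrable_add int1 int2 le)
  also have "\<dots> = 2 * (\<integral>x. exp (c * \<bar>x\<bar>) \<partial>\<mu>)"
    using int1 int2 eq1 eq2 by simp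
  finally show "(\<integral>x. exp (c' * \<bar>x\<bar>) \<partial>linear_law u v \<nu>) \<le> 2 * (\<integral>x. exp (c * \<bar>x\<bar>) \<partial>\<mu>)" .
qed

end

text \<open>An asymptotic independence criterion: \<open>u\<^sup>k + v\<^sup>k\<close> is the factor by which the coefficients of \<open>\<mu>\<close> are multiplied for \<open>u x + v y\<close>
  with independent \<open>x\<close> and \<open>y\<close> of law \<open>\<mu>\<close>.\<close>

lemma converges_weakly_product_if_log_coeffs_tendsto:
  fixes \<nu> :: "real \<Rightarrow> (real \<times> real) measure"
  assumes \<nu>: "\<And>\<tau>. prob_space (\<nu> \<tau>)" "\<And>\<tau>. sets (\<nu> \<tau>) = sets borel"
    and marg: "\<And>\<tau>. distr (\<nu> \<tau>) borel fst = \<mu>" "\<And>\<tau>. distr (\<nu> \<tau>) borel snd = \<mu>"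
    and \<mu>: "real_distribution \<mu>" "log_coeffs (complex_char \<mu>) \<kappa>"
    and \<kappa>: "\<And>u v \<tau>. log_coeffs (complex_char (linear_law u v (\<nu> \<tau>))) (\<kappa>' u v \<tau>)"
    and lim: "\<And>u v k. ((\<lambda>\<tau>. \<kappa>' u v \<tau> k) \<longlongrightarrow> \<kappa> k * of_real (u ^ k + v ^ k)) at_top"
  shows "converges_weakly \<nu> (\<mu> \<Otimes>\<^sub>M \<mu>) at_top"
proof -
  interpret \<mu>: real_distribution \<mu> by fact
  interpret pair_prob_space \<mu> \<mu> ..
  have prob: "prob_space (\<mu> \<Otimes>\<^sub>M \<mu>)"
    by (rule prob_space_axioms)
  have sets: "sets (\<mu> \<Otimes>\<^sub>M \<mu>) = sets borel"
    unfolding borel_prod[symmetric] by (rule sets_pair_measure_cong) simp_all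
  have "distr (\<mu> \<Otimes>\<^sub>M \<mu>) borel fst = distr (\<mu> \<Otimes>\<^sub>M \<mu>) \<mu> fst"
    by (rule distr_cong) simp_all
  then have marg1: "distr (\<mu> \<Otimes>\<^sub>M \<mu>) borel fst = \<mu>"
    by (simp only: \<mu>.distr_pair_fst)
  have "distr (\<mu> \<Otimes>\<^sub>M \<mu>) borel snd = distr (\<mu> \<Otimes>\<^sub>M \<mu>) \<mu> snd"
    by (rule distr_cong) simp_all
  then have marg2: "distr (\<mu> \<Otimes>\<^sub>M \<mu>) borel snd = \<mu>"
    by (simp only: distr_pair_snd_prob[OF \<mu>.prob_space_axioms \<mu>.prob_space_axioms])
  obtain c where c: "c > 0" "integrable \<mu> (\<lambda>x. exp (c * \<bar>x\<bar>))"
    using log_coeffs_exponential_moment[OF \<mu>] by auto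
  show ?thesis
  proof (rule converges_weakly_if_char_tendsto[OF \<nu> prob sets marg marg1 marg2])
    fix u v :: real
    have \<kappa>_prod: "log_coeffs (complex_char (linear_law u v (\<mu> \<Otimes>\<^sub>M \<mu>))) (\<lambda>k. \<kappa> k * of_real (u ^ k + v ^ k))"
    proof (rule log_coeffs_product[OF \<mu>(2)])
      fix x :: real
      have int: "integrable (\<mu> \<Otimes>\<^sub>M \<mu>) (\<lambda>p. iexp ((x * u) * fst p + (x * v) * snd p))"
      proof (rule integrable_const_bound[where B = 1])
        show "(\<lambda>p. iexp ((x * u) * fst p + (x * v) * snd p)) \<in> borel_measurable (\<mu> \<Otimes>\<^sub>M \<mu>)"
          unfolding measurable_cong_sets[OF sets refl] by measurable
      qed simp
      have "complex_char (linear_law u v (\<mu> \<Otimes>\<^sub>M \<mu>)) (of_real x) =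
          (\<integral>p. iexp ((x * u) * fst p + (x * v) * snd p) \<partial>(\<mu> \<Otimes>\<^sub>M \<mu>))"
        by (simp only: char_eq_complex_char[symmetric] char_linear_law[OF prob sets])
      also have "\<dots> = (\<integral>a. (\<integral>b. iexp ((x * u) * fst (a, b) + (x * v) * snd (a, b)) \<partial>\<mu>) \<partial>\<mu>)"
        by (rule integral_fst'[OF int, symmetric])
      also have "\<dots> = (\<integral>a. (\<integral>b. iexp ((u * x) * a) * iexp ((v * x) * b) \<partial>\<mu>) \<partial>\<mu>)"
        by (simp add: exp_add[symmetric] algebra_simps)
      also have "\<dots> = char \<mu> (u * x) * char \<mu> (v * x)"
        by (simp only: char_def integral_mult_right_zero integral_mult_left_zero)
      finally show "complex_char (linear_law u v (\<mu> \<Otimes>\<^sub>M \<mu>)) (of_real x) =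
          complex_char \<mu> (of_real (u * x)) * complex_char \<mu> (of_real (v * x))"
        by (simp only: char_eq_complex_char)
    qed
    define d where "d = 1 + \<bar>u\<bar> + \<bar>v\<bar>"
    define c' where "c' = c / (2 * d)"
    have "d > 0"
      by (simp add: d_def)
    then have "c' > 0" "c' \<ge> 0" "2 * c' * d \<le> c"
      using c(1) by (simp_all add: c'_def)
    note c' = this[unfolded d_def]
    have "((\<lambda>\<tau>. char (linear_law u v (\<nu> \<tau>)) 1) \<longlongrightarrow> char (linear_law u v (\<mu> \<Otimes>\<^sub>M \<mu>)) 1) at_top"
    proof (rule tendsto_at_topI_sequentially)
      fix X :: "nat \<Rightarrow> real" assume X: "filterlim X at_top sequentially"
      show "(\<lambda>n. char (linear_law u v (\<nu> (X n))) 1) \<longlonglongrightarrow> char (linear_law u v (\<mu> \<Otimes>\<^sub>M \<mu>)) 1"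
      proof (rule char_tendsto_if_log_coeffs_tendsto[where c = c' and \<kappa> = "\<lambda>n. \<kappa>' u v (X n)"
            and B = "2 * (\<integral>x. exp (c * \<bar>x\<bar>) \<partial>\<mu>)"])
        show "(\<lambda>n. \<kappa>' u v (X n) k) \<longlonglongrightarrow> \<kappa> k * of_real (u ^ k + v ^ k)" for k
          by (rule filterlim_compose[OF lim X])
        show "integrable (linear_law u v (\<nu> (X n))) (\<lambda>x. exp (c' * \<bar>x\<bar>))" for n
          by (rule linear_law_exponential_moment(1)[OF \<nu> marg c(2) c'(2,3)])
        show "(\<integral>x. exp (c' * \<bar>x\<bar>) \<partial>linear_law u v (\<nu> (X n))) \<le> 2 * (\<integral>x. exp (c * \<bar>x\<bar>) \<partial>\<mu>)" for n
          by (rule linear_law_exponential_moment(2)[OF \<nu> marg c(2) c'(2,3)])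
        show "integrable (linear_law u v (\<mu> \<Otimes>\<^sub>M \<mu>)) (\<lambda>x. exp (c' * \<bar>x\<bar>))"
          by (rule linear_law_exponential_moment(1)[OF prob sets marg1 marg2 c(2) c'(2,3)])
      qed (rule real_distribution_linear_law \<nu> prob sets c' \<kappa> \<kappa>_prod)+
    qed
    then show "((\<lambda>\<tau>. \<integral>p. iexp (u * fst p + v * snd p) \<partial>\<nu> \<tau>) \<longlongrightarrow>
        (\<integral>p. iexp (u * fst p + v * snd p) \<partial>(\<mu> \<Otimes>\<^sub>M \<mu>))) at_top"
      by (simp only: char_linear_law[OF \<nu>] char_linear_law[OF prob sets] mult_1_left)
  qed
qed

text \<open>The coefficients of \<open>1 / 2 * (\<Sum>k\<ge>2. (2 \<i> \<sigma>)\<^sup>k / k * R\<^sub>k)\<close> as a power series in a common factor of the \<open>\<theta>\<^sub>j\<close>, by homogeneity of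
  \<open>R\<^sub>k\<close>.\<close>

definition rosenblatt_log_coeff :: "real \<Rightarrow> (real \<Rightarrow> real) \<Rightarrow> nat \<Rightarrow> complex" where
  "rosenblatt_log_coeff H \<psi> k = (if k < 2 then 0
     else 1 / 2 * ((2 * \<i> * of_real (rosenblatt_sigma H)) ^ k / of_nat k * of_real (cyclic_integral H k \<psi>)))"

lemma step_psi_increments:
  assumes "0 \<le> s" "s < t" "0 \<le> \<tau>"
  shows "step_psi 4 (\<lambda>j. x * ([u, - u, v, - v] ! j)) (\<lambda>j. [t, s, t + \<tau>, s + \<tau>] ! j) y =
    x * (u * indicator {s<..t} y + v * indicator {s + \<tau><..t + \<tau>} y)"
proof -
  have "indicator {0..b} y - indicator {0..a} y = (indicator {a<..b} y :: real)" if "0 \<le> a" "a < b" for a b :: real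
    using that by (auto simp: indicator_def)
  from this[of s t] this[of "s + \<tau>" "t + \<tau>"]
  have *: "indicator {s<..t} y = indicator {0..t} y - (indicator {0..s} y :: real)"
    "indicator {s + \<tau><..t + \<tau>} y = indicator {0..t + \<tau>} y - (indicator {0..s + \<tau>} y :: real)"
    using assms by simp_all
  show ?thesis
    unfolding * by (simp add: step_psi_def eval_nat_numeral algebra_simps)
qed

text \<open>The finite-dimensional formula at the four times \<open>t, s, t + \<tau>, s + \<tau>\<close> with the coefficients \<open>x u, - x u, x v, - x v\<close>. The cases
  \<open>(u, v) = (1, 0)\<close> and \<open>(0, 1)\<close> cover the single increments.\<close>

lemma rosenblatt_increment_log_coeffs:
  assumes ros: "rosenblatt_process H M \<xi>" and st: "0 \<le> s" "s < t" "0 \<le> \<tau>"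
  shows "log_coeffs (complex_char (distr M borel (\<lambda>\<omega>. u * (\<xi> t \<omega> - \<xi> s \<omega>) + v * (\<xi> (t + \<tau>) \<omega> - \<xi> (s + \<tau>) \<omega>))))
    (rosenblatt_log_coeff H (\<lambda>y. u * indicator {s<..t} y + v * indicator {s + \<tau><..t + \<tau>} y))"
proof -
  define T where "T = (\<lambda>j. [t, s, t + \<tau>, s + \<tau>] ! j)"
  define a where "a = (\<lambda>j. [u, - u, v, - v] ! j)"
  define \<psi> where "\<psi> = (\<lambda>y. u * indicator {s<..t} y + v * indicator {s + \<tau><..t + \<tau>} y :: real)"
  define Z where "Z = (\<lambda>\<omega>. u * (\<xi> t \<omega> - \<xi> s \<omega>) + v * (\<xi> (t + \<tau>) \<omega> - \<xi> (s + \<tau>) \<omega>))"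
  have less4: "j < 4 \<longleftrightarrow> j = 0 \<or> j = 1 \<or> j = 2 \<or> j = 3" for j :: nat
    by auto
  have "\<forall>j<4. 0 \<le> T j"
    using st by (auto simp: less4 T_def)
  then have "\<exists>\<epsilon>>0. \<forall>\<theta>. (\<forall>j<4. \<bar>\<theta> j\<bar> < \<epsilon>) \<longrightarrow>
           summable (\<lambda>k. cumulant_term H 4 \<theta> T (k + 2)) \<and>
           (\<integral>\<omega>. exp (\<i> * of_real (\<Sum>j<4. \<theta> j * \<xi> (T j) \<omega>)) \<partial>M) =
             exp (1 / 2 * (\<Sum>k. cumulant_term H 4 \<theta> T (k + 2)))"
    by (rule ros[unfolded rosenblatt_process_def, THEN conjunct2, THEN conjunct2, THEN spec, of 4, THEN spec, of T, THEN mp])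
  then obtain \<epsilon> where \<epsilon>: "\<epsilon> > 0" and *: "\<forall>\<theta>. (\<forall>j<4. \<bar>\<theta> j\<bar> < \<epsilon>) \<longrightarrow>
           summable (\<lambda>k. cumulant_term H 4 \<theta> T (k + 2)) \<and>
           (\<integral>\<omega>. exp (\<i> * of_real (\<Sum>j<4. \<theta> j * \<xi> (T j) \<omega>)) \<partial>M) =
             exp (1 / 2 * (\<Sum>k. cumulant_term H 4 \<theta> T (k + 2)))"
    by (elim exE conjE)
  have Z_meas: "Z \<in> borel_measurable M"
    unfolding Z_def using ros st
    by (intro borel_measurable_add borel_measurable_times borel_measurable_diff borel_measurable_const)
      (simp_all add: rosenblatt_process_def)
  define \<epsilon>' where "\<epsilon>' = \<epsilon> / (1 + \<bar>u\<bar> + \<bar>v\<bar>)"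
  have \<epsilon>': "\<epsilon>' > 0"
    using \<epsilon> by (simp add: \<epsilon>'_def add_pos_nonneg)
  have "log_coeffs (complex_char (distr M borel Z)) (rosenblatt_log_coeff H \<psi>)"
    unfolding log_coeffs_def
  proof (rule exI[of _ \<epsilon>'], rule conjI[OF \<epsilon>'], rule allI, rule impI)
    fix x :: real assume x: "\<bar>x\<bar> < \<epsilon>'"
    let ?\<theta> = "\<lambda>j. x * a j"
    have "\<bar>x * a j\<bar> < \<epsilon>" if "j < 4" for j
    proof -
      have "\<bar>a j\<bar> \<le> 1 + \<bar>u\<bar> + \<bar>v\<bar>"
        using that by (auto simp: less4 a_def)
      then have "\<bar>x * a j\<bar> \<le> \<bar>x\<bar> * (1 + \<bar>u\<bar> + \<bar>v\<bar>)"
        unfolding abs_mult by (intro mult_left_mono) auto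
      also have "\<dots> < \<epsilon>"
        using x by (simp add: \<epsilon>'_def pos_less_divide_eq add_pos_nonneg)
      finally show ?thesis .
    qed
    then have "summable (\<lambda>k. cumulant_term H 4 ?\<theta> T (k + 2)) \<and>
           (\<integral>\<omega>. exp (\<i> * of_real (\<Sum>j<4. ?\<theta> j * \<xi> (T j) \<omega>)) \<partial>M) =
             exp (1 / 2 * (\<Sum>k. cumulant_term H 4 ?\<theta> T (k + 2)))"
      using *[THEN spec, of ?\<theta>] by simp
    then have sm: "summable (\<lambda>k. cumulant_term H 4 ?\<theta> T (k + 2))"
      and cf: "(\<integral>\<omega>. exp (\<i> * of_real (\<Sum>j<4. ?\<theta> j * \<xi> (T j) \<omega>)) \<partial>M) =
             exp (1 / 2 * (\<Sum>k. cumulant_term H 4 ?\<theta> T (k + 2)))"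
      by simp_all
    have psi: "step_psi 4 ?\<theta> T = (\<lambda>y. x * \<psi> y)"
      using step_psi_increments[OF st] by (simp add: fun_eq_iff T_def a_def \<psi>_def)
    have coeff_eq: "rosenblatt_log_coeff H \<psi> (k + 2) * of_real x ^ (k + 2) = 1 / 2 * cumulant_term H 4 ?\<theta> T (k + 2)" for k
      by (simp add: rosenblatt_log_coeff_def cumulant_term_def cyclic_R_eq psi cyclic_integral_scale)
    have "summable (\<lambda>k. rosenblatt_log_coeff H \<psi> (k + 2) * of_real x ^ (k + 2))"
      unfolding coeff_eq by (rule summable_mult[OF sm])
    then have sm': "summable (\<lambda>k. rosenblatt_log_coeff H \<psi> k * of_real x ^ k)"
      by (rule summable_iff_shift[of "\<lambda>k. rosenblatt_log_coeff H \<psi> k * of_real x ^ k" 2, THEN iffD1])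
    have "(\<Sum>k. rosenblatt_log_coeff H \<psi> k * of_real x ^ k) =
        (\<Sum>k. rosenblatt_log_coeff H \<psi> (k + 2) * of_real x ^ (k + 2)) +
        (\<Sum>k<2. rosenblatt_log_coeff H \<psi> k * of_real x ^ k)"
      by (rule suminf_split_initial_segment[OF sm'])
    also have "(\<Sum>k<2. rosenblatt_log_coeff H \<psi> k * of_real x ^ k) = 0"
      by (rule sum.neutral) (simp add: rosenblatt_log_coeff_def)
    also have "(\<Sum>k. rosenblatt_log_coeff H \<psi> (k + 2) * of_real x ^ (k + 2)) =
        1 / 2 * (\<Sum>k. cumulant_term H 4 ?\<theta> T (k + 2))"
      unfolding coeff_eq by (rule suminf_mult[OF sm])
    finally have sum: "(\<Sum>k. rosenblatt_log_coeff H \<psi> k * of_real x ^ k) = 1 / 2 * (\<Sum>k. cumulant_term H 4 ?\<theta> T (k + 2))"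
      by simp
    have "(\<Sum>j<4. ?\<theta> j * \<xi> (T j) \<omega>) = x * Z \<omega>" for \<omega>
      by (simp add: eval_nat_numeral a_def T_def Z_def algebra_simps)
    then have "(\<integral>\<omega>. exp (\<i> * of_real (\<Sum>j<4. ?\<theta> j * \<xi> (T j) \<omega>)) \<partial>M) = (\<integral>\<omega>. exp (\<i> * of_real x * of_real (Z \<omega>)) \<partial>M)"
      by (simp add: mult.assoc)
    also have "\<dots> = complex_char (distr M borel Z) (of_real x)"
      unfolding complex_char_def by (rule integral_distr[OF Z_meas, symmetric]) measurable
    finally have "complex_char (distr M borel Z) (of_real x) = exp (\<Sum>k. rosenblatt_log_coeff H \<psi> k * of_real x ^ k)"
      unfolding cf sum ..
    with sm' show "summable (\<lambda>k. rosenblatt_log_coeff H \<psi> k * of_real x ^ k) \<and>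
        complex_char (distr M borel Z) (of_real x) = exp (\<Sum>k. rosenblatt_log_coeff H \<psi> k * of_real x ^ k)" ..
  qed
  then show ?thesis
    by (simp only: Z_def \<psi>_def)
qed

theorem corollary4p2:
  fixes H s t :: real
    and M :: "'a measure"
    and \<xi> :: "real \<Rightarrow> 'a \<Rightarrow> real"
  assumes "1 / 2 < H" and "H < 1"
    and "rosenblatt_process H M \<xi>"
    and "0 < s" and "s < t"
  shows "converges_weakly
           (\<lambda>\<tau>. joint_increment_law M \<xi> s t (s + \<tau>) (t + \<tau>))
           (increment_law M \<xi> s t \<Otimes>\<^sub>M increment_law M \<xi> s t)
           at_top
         \<and> (\<forall>\<tau>>0. increment_law M \<xi> s t \<Otimes>\<^sub>M increment_law M \<xi> s t =
                   increment_law M \<xi> s t \<Otimes>\<^sub>M increment_law M \<xi> (s + \<tau>) (t + \<tau>))"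
proof -
  note ros = assms(3)
  interpret prob_space M
    using ros by (simp add: rosenblatt_process_def)
  have meas: "\<xi> w \<in> borel_measurable M" if "w \<ge> 0" for w
    using ros that by (simp add: rosenblatt_process_def)
  have [measurable]: "\<xi> s \<in> borel_measurable M" "\<xi> t \<in> borel_measurable M"
    using assms meas by simp_all
  define \<mu> where "\<mu> = increment_law M \<xi> s t"
  define \<kappa> where "\<kappa> = rosenblatt_log_coeff H (indicator {s<..t})"
  have dist: "real_distribution (increment_law M \<xi> (s + \<tau>) (t + \<tau>))" if "\<tau> \<ge> 0" for \<tau>
  proof -
    have [measurable]: "\<xi> (s + \<tau>) \<in> borel_measurable M" "\<xi> (t + \<tau>) \<in> borel_measurable M"
      using assms that meas by simp_all
    show ?thesis
      unfolding increment_law_def by (rule real_distribution_distr) measurable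
  qed
  have coeffs: "log_coeffs (complex_char (increment_law M \<xi> (s + \<tau>) (t + \<tau>))) \<kappa>" if "\<tau> \<ge> 0" for \<tau>
  proof -
    have "indicator {s + \<tau><..t + \<tau>} y = (indicator {s<..t} (y - \<tau>) :: real)" for y
      by (auto simp: indicator_def)
    then have "rosenblatt_log_coeff H (\<lambda>y. 0 * indicator {s<..t} y + 1 * indicator {s + \<tau><..t + \<tau>} y) = \<kappa>"
      by (simp add: \<kappa>_def rosenblatt_log_coeff_def fun_eq_iff cyclic_integral_translate)
    then show ?thesis
      using rosenblatt_increment_log_coeffs[OF ros _ assms(5) that, of 0 1] assms(4)
      by (simp add: increment_law_def)
  qed
  have \<mu>: "real_distribution \<mu>" "log_coeffs (complex_char \<mu>) \<kappa>"
    using dist[of 0] coeffs[of 0] by (simp_all add: \<mu>_def)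
  have stationary: "increment_law M \<xi> (s + \<tau>) (t + \<tau>) = \<mu>" if "\<tau> \<ge> 0" for \<tau>
    by (rule log_coeffs_unique[OF dist[OF that] \<mu>(1) coeffs[OF that] \<mu>(2)])
  (* The process is only constrained at nonnegative times, so negative shifts are replaced by 0. *)
  define \<nu> where "\<nu> = (\<lambda>\<tau>. joint_increment_law M \<xi> s t (s + max 0 \<tau>) (t + max 0 \<tau>))"
  have pair_meas: "(\<lambda>\<omega>. (\<xi> t \<omega> - \<xi> s \<omega>, \<xi> (t + max 0 \<tau>) \<omega> - \<xi> (s + max 0 \<tau>) \<omega>)) \<in> borel_measurable M" for \<tau>
  proof -
    have [measurable]: "\<xi> (s + max 0 \<tau>) \<in> borel_measurable M" "\<xi> (t + max 0 \<tau>) \<in> borel_measurable M"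
      using assms by (auto intro!: meas)
    show ?thesis
      by measurable
  qed
  have linear: "linear_law u v (\<nu> \<tau>) = distr M borel
      (\<lambda>\<omega>. u * (\<xi> t \<omega> - \<xi> s \<omega>) + v * (\<xi> (t + max 0 \<tau>) \<omega> - \<xi> (s + max 0 \<tau>) \<omega>))" for u v \<tau>
    unfolding linear_law_def \<nu>_def joint_increment_law_def
    by (subst distr_distr[OF _ pair_meas]) (simp_all add: o_def)
  have "converges_weakly \<nu> (\<mu> \<Otimes>\<^sub>M \<mu>) at_top"
  proof (rule converges_weakly_product_if_log_coeffs_tendsto[OF _ _ _ _ \<mu>])
    show "prob_space (\<nu> \<tau>)" for \<tau>
      unfolding \<nu>_def joint_increment_law_def by (rule prob_space_distr[OF pair_meas])
    show "sets (\<nu> \<tau>) = sets borel" for \<tau>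
      by (simp add: \<nu>_def joint_increment_law_def)
    show "distr (\<nu> \<tau>) borel fst = \<mu>" for \<tau>
      using linear[of 1 0 \<tau>] by (simp add: linear_law_def \<mu>_def increment_law_def)
    show "distr (\<nu> \<tau>) borel snd = \<mu>" for \<tau>
      using linear[of 0 1 \<tau>] stationary[of "max 0 \<tau>"] by (simp add: linear_law_def increment_law_def)
    show "log_coeffs (complex_char (linear_law u v (\<nu> \<tau>))) (rosenblatt_log_coeff H
        (\<lambda>y. u * indicator {s<..t} y + v * indicator {s + max 0 \<tau><..t + max 0 \<tau>} y))" for u v \<tau>
      unfolding linear using assms by (intro rosenblatt_increment_log_coeffs) auto
    show "((\<lambda>\<tau>. rosenblatt_log_coeff H (\<lambda>y. u * indicator {s<..t} y + v * indicator {s + max 0 \<tau><..t + max 0 \<tau>} y) k)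
        \<longlongrightarrow> \<kappa> k * of_real (u ^ k + v ^ k)) at_top" for u v k
    proof (cases "k < 2")
      case True
      then show ?thesis
        by (simp add: rosenblatt_log_coeff_def \<kappa>_def)
    next
      case False
      have "((\<lambda>\<tau>. cyclic_integral H k (\<lambda>y. u * indicator {s<..t} y + v * indicator {s + \<tau><..t + \<tau>} y))
          \<longlongrightarrow> (u ^ k + v ^ k) * cyclic_integral H k (indicator {s<..t})) at_top"
        using False assms by (intro cyclic_integral_tendsto) auto
      moreover have "filterlim (\<lambda>\<tau>::real. max 0 \<tau>) at_top at_top"
        by (rule filterlim_at_top_mono[OF filterlim_ident]) auto
      ultimately have "((\<lambda>\<tau>. cyclic_integral H k (\<lambda>y. u * indicator {s<..t} y + v * indicator {s + max 0 \<tau><..t + max 0 \<tau>} y))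
          \<longlongrightarrow> (u ^ k + v ^ k) * cyclic_integral H k (indicator {s<..t})) at_top"
        by (rule filterlim_compose)
      then have "((\<lambda>\<tau>. 1 / 2 * ((2 * \<i> * of_real (rosenblatt_sigma H)) ^ k / of_nat k *
            complex_of_real (cyclic_integral H k (\<lambda>y. u * indicator {s<..t} y + v * indicator {s + max 0 \<tau><..t + max 0 \<tau>} y))))
          \<longlongrightarrow> 1 / 2 * ((2 * \<i> * of_real (rosenblatt_sigma H)) ^ k / of_nat k *
            complex_of_real ((u ^ k + v ^ k) * cyclic_integral H k (indicator {s<..t})))) at_top"
        by (intro tendsto_mult tendsto_const tendsto_of_real)
      then show ?thesis
        using False by (simp add: rosenblatt_log_coeff_def \<kappa>_def mult_ac)
    qed
  qed
  moreover have "eventually (\<lambda>\<tau>. \<nu> \<tau> = joint_increment_law M \<xi> s t (s + \<tau>) (t + \<tau>)) at_top"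
    using eventually_ge_at_top[of 0] by eventually_elim (simp add: \<nu>_def)
  ultimately have "converges_weakly (\<lambda>\<tau>. joint_increment_law M \<xi> s t (s + \<tau>) (t + \<tau>)) (\<mu> \<Otimes>\<^sub>M \<mu>) at_top"
    unfolding converges_weakly_def
    by (auto elim!: eventually_mono intro: Lim_transform_eventually)
  moreover have "\<forall>\<tau>>0. \<mu> \<Otimes>\<^sub>M \<mu> = \<mu> \<Otimes>\<^sub>M increment_law M \<xi> (s + \<tau>) (t + \<tau>)"
    using stationary by simp
  ultimately show ?thesis
    by (simp only: \<mu>_def)
qed

end
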